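(* Let $\mathcal A\in\mathbb R^{m\times n\times p}$, $\mathcal B\in\mathbb R^{m\times 1\times p}$, let $\mathcal K$ be a real third order tensor of size $q\times n\times p$, and let $\delta$ be the given bound. Consider the tensor regularized total least squares (TR-TLS) problem $$\min_{\tilde{\mathcal A},\tilde{\mathcal B},\mathcal X}\left\|(\mathcal A,\mathcal B)-(\tilde{\mathcal A},\tilde{\mathcal A}*\mathcal X)\right\|_F\quad\text{s.t.}\quad \tilde{\mathcal B}=\tilde{\mathcal A}*\mathcal X,\quad \|\mathcal K*\mathcal X\|_F\le\delta.$$ If the constraint $\|\mathcal K*\mathcal X\|_F\le\delta$ is active, then the solution $\mathcal X^*\in\mathbb R^{n\times1\times p}$ of the TR-TLS problem satisfies $$\Psi(\mathcal X^* )*\begin{pmatrix}\mathcal X^*\\-\mathcal I_{11p}\end{pmatrix}=-\begin{pmatrix}\mathcal X^*\\-\mathcal I_{11p}\end{pmatrix}*\widetilde{\lambda_I},$$ where $$\Psi(\mathcal X^* )=\begin{pmatrix}\mathcal A^\top*\mathcal A+\mathcal K^\top*\mathcal K*(\widetilde{\lambda_K}\otimes\mathcal I_{nnp}) & \mathcal A^\top*\mathcal B\\ \mathcal B^\top*\mathcal A & -\widetilde{\lambda_K}*(\mathcal X^* )^\top*\mathcal K^\top*\mathcal K*\mathcal X^*+\mathcal B^\top*\mathcal B\end{pmatrix}$$ and the tubes $\widetilde{\lambda_I},\widetilde{\lambda_K}\in\mathbb R^{1\times1\times p}$ are $$\widetilde{\lambda_I}=\mu\,(\mathcal X^* )^\top*\mathcal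 K^\top*\mathcal K*\mathcal X^*-\mathbf R^\top*\mathbf R*(\mathcal X^* )^\top*\mathcal X^*-\mathbf R^\top*\mathcal B,\qquad \widetilde{\lambda_K}=\mu(\mathcal I_{11p}+(\mathcal X^* )^\top*\mathcal X^* ),$$ with $\mu\in\mathbb R$ the Lagrange multiplier corresponding to the solution and $\mathbf R=\mathcal B-\tilde{\mathcal A}*\mathcal X^*$, where $\tilde{\mathcal A}$ is the $\tilde{\mathcal A}$-component of the solution.
   Context: Notation. For $\mathcal A\in\mathbb R^{m\times n\times p}$ let $A^{(i)}\in\mathbb R^{m\times n}$ ($i=1,\dots,p$) be its frontal slices $\mathcal A[:,:,i]$. $\mathrm{bcirc}(\mathcal A)\in\mathbb R^{mp\times np}$ is the block circulant matrix whose first block column is $A^{(1)},A^{(2)},\dots,A^{(p)}$, i.e. whose $(i,j)$ block is $A^{(((i-j)\bmod p)+1)}$. It is block-diagonalized as $\mathrm{bcirc}(\mathcal A)=(F_p^{\rm H}\otimes I_m)\,\mathrm{diag}(A_1,\dots,A_p)\,(F_p\otimes I_n)$ with $A_i\in\mathbb C^{m\times n}$, where $F_p=\frac1{\sqrt p}(\omega^{(i-1)(j-1)})_{i,j=1}^p$, $\omega=e^{-2\pi \mathbf i/p}$. $\mathrm{unfold}(\mathcal B)$ stacks the frontal slices $B^{(1)},\dots,B^{(p)}$ vertically, and $\mathrm{fold}$ is its inverse. The T-product of $\mathcal A\in\mathbb R^{m\times n\times p}$ and $\mathcal B\in\mathbb R^{n\times s\times p}$ is $\mathcal A*\mathcal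 B=\mathrm{fold}(\mathrm{bcirc}(\mathcal A)\,\mathrm{unfold}(\mathcal B))\in\mathbb R^{m\times s\times p}$. The transpose $\mathcal A^\top\in\mathbb R^{n\times m\times p}$ has frontal slices $\mathcal A^\top[:,:,1]=\mathcal A[:,:,1]^\top$ and $\mathcal A^\top[:,:,i]=\mathcal A[:,:,p+2-i]^\top$ for $i=2,\dots,p$. The identity tensor $\mathcal I_{nnp}\in\mathbb R^{n\times n\times p}$ has first frontal slice $I_n$ and all other frontal slices zero ($\mathcal I_{11p}$ is the case $n=1$). The Kronecker product (based on the T-product) of $\mathcal A\in\mathbb R^{m\times n\times p}$ and $\mathcal B\in\mathbb R^{t\times s\times p}$, with diagonal blocks $A_i\in\mathbb C^{m\times n}$, $B_i\in\mathbb C^{t\times s}$ in the block diagonalizations $\mathrm{bcirc}(\mathcal A)=(F_p^{\rm H}\otimes I_m)\,\mathrm{diag}(A_1,\dots,A_p)\,(F_p\otimes I_n)$ and $\mathrm{bcirc}(\mathcal B)=(F_p^{\rm H}\otimes I_t)\,\mathrm{diag}(B_1,\dots,B_p)\,(F_p\otimes I_s)$, is $\mathcal A\otimes\mathcal B=\mathrm{bcirc}^{-1}\big((F_p^{\rm H}\otimes I_{mt})\,\mathrm{diag}(A_1\otimes B_1,\dots,A_p\otimes B_p)\,(F_p\otimes I_{ns})\big)\in\mathbb R^{mt\times ns\times p}$. The Frobenius norm is $\|\mathcal X\|_F=\sqrt{\sum_{i,j,k}x_{ijk}^2}$. $(\mathcal A,\mathcal B)$ denotes concatenation along the second mode; block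 tensors are formed by concatenation along the first and second modes (i.e. frontal slice by frontal slice). A tube is an element of $\mathbb R^{1\times1\times p}$. The constraint is active if it holds with equality at the solution, $\|\mathcal K*\mathcal X^*\|_F=\delta$. Lagrange multiplier: the Lagrangian of the TR-TLS problem is $\hat{\mathcal L}(\tilde{\mathcal A},\mathcal X,\mu)=\|(\mathcal A,\mathcal B)-(\tilde{\mathcal A},\tilde{\mathcal A}*\mathcal X)\|_F^2+\mu(\|\mathcal K*\mathcal X\|_F^2-\delta^2)$; $\mu$ being the corresponding Lagrange multiplier means that the partial derivatives of $\hat{\mathcal L}$ with respect to $\tilde{\mathcal A}$ and $\mathcal X$ vanish at the solution $(\tilde{\mathcal A},\mathcal X^* )$ with this $\mu$. *)

theory Defs
  imports Complex_Main "Jordan_Normal_Form.Schur_Decomposition"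
begin

text \<open>
  A third order tensor is the list of its frontal slices: the entry \<open>x\<^sub>i\<^sub>j\<^sub>k\<close> is
  \<open>X ! k $$ (i, j)\<close>, with all indices counted from \<open>0\<close>.
  Tensors of size \<open>m \<times> n \<times> p\<close> are only considered for \<open>p > 0\<close>, so that
  \<open>m\<close> and \<open>n\<close> can be read off the first slice.
\<close>

type_synonym tensor = "real mat list"

definition tensors :: "nat \<Rightarrow> nat \<Rightarrow> nat \<Rightarrow> tensor set" where
  "tensors m n p = {T. length T = p \<and> set T \<subseteq> carrier_mat m n}"

definition trow :: "tensor \<Rightarrow> nat" where
  "trow T = dim_row (hd T)"

definition tcol :: "tensor \<Rightarrow> nat" where
  "tcol T = dim_col (hd T)"


text \<open>The summand \<open>length T\<close> keeps the subtraction of block indices from truncating.\<close>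

definition bcirc :: "tensor \<Rightarrow> real mat" where
  "bcirc T = (let m = trow T; n = tcol T; p = length T in
     mat (m * p) (n * p) (\<lambda>(r, c).
       T ! ((p + r div m - c div n) mod p) $$ (r mod m, c mod n)))"

definition tunfold :: "tensor \<Rightarrow> real mat" where
  "tunfold T = (let m = trow T in
     mat (m * length T) (tcol T) (\<lambda>(r, c). T ! (r div m) $$ (r mod m, c)))"

definition tfold :: "nat \<Rightarrow> real mat \<Rightarrow> tensor" where
  "tfold p M = (let m = dim_row M div p in
     map (\<lambda>k. mat m (dim_col M) (\<lambda>(i, j). M $$ (k * m + i, j))) [0..<p])"

definition tprod :: "tensor \<Rightarrow> tensor \<Rightarrow> tensor" (infixl \<open>*\<^sub>T\<close> 70) where
  "A *\<^sub>T B = tfold (length A) (bcirc A * tunfold B)"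

definition ttranspose :: "tensor \<Rightarrow> tensor" (\<open>(_\<^sup>\<top>)\<close> [1000] 1000) where
  "A\<^sup>\<top> = map (\<lambda>k. transpose_mat (A ! (if k = 0 then 0 else length A - k))) [0..<length A]"

definition tid :: "nat \<Rightarrow> nat \<Rightarrow> tensor" where
  "tid n p = map (\<lambda>k. if k = 0 then 1\<^sub>m n else 0\<^sub>m n n) [0..<p]"

definition tplus :: "tensor \<Rightarrow> tensor \<Rightarrow> tensor" (infixl \<open>+\<^sub>T\<close> 65) where
  "A +\<^sub>T B = map2 (+) A B"

definition tminus :: "tensor \<Rightarrow> tensor \<Rightarrow> tensor" (infixl \<open>-\<^sub>T\<close> 65) where
  "A -\<^sub>T B = map2 (-) A B"

definition tuminus :: "tensor \<Rightarrow> tensor" where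
  "tuminus A = map uminus A"

definition tsmult :: "real \<Rightarrow> tensor \<Rightarrow> tensor" (infixr \<open>\<cdot>\<^sub>T\<close> 70) where
  "a \<cdot>\<^sub>T A = map (\<lambda>M. a \<cdot>\<^sub>m M) A"

definition tnorm :: "tensor \<Rightarrow> real" where
  "tnorm X = sqrt (\<Sum>k<length X. \<Sum>i<trow X. \<Sum>j<tcol X. (X ! k $$ (i, j))\<^sup>2)"


definition append_cols :: "'a::zero mat \<Rightarrow> 'a mat \<Rightarrow> 'a mat" where
  "append_cols A B = four_block_mat A B (0\<^sub>m 0 (dim_col A)) (0\<^sub>m 0 (dim_col B))"

definition thcat :: "tensor \<Rightarrow> tensor \<Rightarrow> tensor" where
  "thcat A B = map2 append_cols A B"

definition tvcat :: "tensor \<Rightarrow> tensor \<Rightarrow> tensor" where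
  "tvcat A B = map2 append_rows A B"

definition tblock :: "tensor \<Rightarrow> tensor \<Rightarrow> tensor \<Rightarrow> tensor \<Rightarrow> tensor" where
  "tblock A B C D = tvcat (thcat A B) (thcat C D)"


definition mat_kron :: "'a::times mat \<Rightarrow> 'a mat \<Rightarrow> 'a mat" where
  "mat_kron A B =
     mat (dim_row A * dim_row B) (dim_col A * dim_col B) (\<lambda>(i, j).
       A $$ (i div dim_row B, j div dim_col B) * B $$ (i mod dim_row B, j mod dim_col B))"

definition dft_mat :: "nat \<Rightarrow> complex mat" where
  "dft_mat p = mat p p (\<lambda>(i, j). exp (- 2 * of_real pi * \<i> / of_nat p) ^ (i * j) / of_real (sqrt (real p)))"

text \<open>
  \<open>Ds\<close> is the list of diagonal blocks in the block diagonalization of \<open>bcirc T\<close>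
  by the discrete Fourier transform. For each \<open>T \<in> tensors m n p\<close> with \<open>p > 0\<close>
  there is exactly one such list, namely \<open>Ds ! k = (\<Sum>l<p. \<omega> ^ (k * l) * T ! l)\<close>.
\<close>

definition fourier_blocks :: "nat \<Rightarrow> nat \<Rightarrow> nat \<Rightarrow> tensor \<Rightarrow> complex mat list \<Rightarrow> bool" where
  "fourier_blocks m n p T Ds \<longleftrightarrow>
     length Ds = p \<and> set Ds \<subseteq> carrier_mat m n \<and>
     map_mat complex_of_real (bcirc T) =
       mat_kron (mat_adjoint (dft_mat p)) (1\<^sub>m m) * diag_block_mat Ds * mat_kron (dft_mat p) (1\<^sub>m n)"

text \<open>
  The description operator renders the inverse of \<open>bcirc\<close>. The tensor exists and is real
  since the blocks \<open>mat_kron (As ! k) (Bs ! k)\<close> inherit the conjugate symmetry of \<open>As\<close> and \<open>Bs\<close>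
  in \<open>k\<close>; it is unique since \<open>bcirc\<close> is injective on tensors of a given size.
\<close>

definition tkron :: "tensor \<Rightarrow> tensor \<Rightarrow> tensor" where
  "tkron A B =
     (let m = trow A; n = tcol A; t = trow B; s = tcol B; p = length A in
      THE C. C \<in> tensors (m * t) (n * s) p \<and>
        (\<exists>As Bs. fourier_blocks m n p A As \<and> fourier_blocks t s p B Bs \<and>
           fourier_blocks (m * t) (n * s) p C (map2 mat_kron As Bs)))"


definition tr_tls_objective :: "tensor \<Rightarrow> tensor \<Rightarrow> tensor \<Rightarrow> tensor \<Rightarrow> real" where
  "tr_tls_objective A B At X = tnorm (thcat A B -\<^sub>T thcat At (At *\<^sub>T X))"

definition tr_tls_feasible ::
  "nat \<Rightarrow> nat \<Rightarrow> nat \<Rightarrow> tensor \<Rightarrow> real \<Rightarrow> tensor \<Rightarrow> tensor \<Rightarrow> tensor \<Rightarrow> bool" where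
  "tr_tls_feasible m n p K \<delta> At Bt X \<longleftrightarrow>
     At \<in> tensors m n p \<and> Bt \<in> tensors m 1 p \<and> X \<in> tensors n 1 p \<and>
     Bt = At *\<^sub>T X \<and> tnorm (K *\<^sub>T X) \<le> \<delta>"

definition tr_tls_solution ::
  "nat \<Rightarrow> nat \<Rightarrow> nat \<Rightarrow> tensor \<Rightarrow> tensor \<Rightarrow> tensor \<Rightarrow> real \<Rightarrow> tensor \<Rightarrow> tensor \<Rightarrow> tensor \<Rightarrow> bool" where
  "tr_tls_solution m n p A B K \<delta> At Bt X \<longleftrightarrow>
     tr_tls_feasible m n p K \<delta> At Bt X \<and>
     (\<forall>At' Bt' X'. tr_tls_feasible m n p K \<delta> At' Bt' X' \<longrightarrow>
        tr_tls_objective A B At X \<le> tr_tls_objective A B At' X')"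

definition tr_tls_lagrangian ::
  "tensor \<Rightarrow> tensor \<Rightarrow> tensor \<Rightarrow> real \<Rightarrow> tensor \<Rightarrow> tensor \<Rightarrow> real \<Rightarrow> real" where
  "tr_tls_lagrangian A B K \<delta> At X \<mu> =
     (tnorm (thcat A B -\<^sub>T thcat At (At *\<^sub>T X)))\<^sup>2 + \<mu> * ((tnorm (K *\<^sub>T X))\<^sup>2 - \<delta>\<^sup>2)"

definition tupdate :: "tensor \<Rightarrow> nat \<Rightarrow> nat \<Rightarrow> nat \<Rightarrow> real \<Rightarrow> tensor" where
  "tupdate T i j k x =
     T[k := mat (dim_row (T ! k)) (dim_col (T ! k))
              (\<lambda>(a, b). if a = i \<and> b = j then x else T ! k $$ (a, b))]"

text \<open>The derivative of \<open>f\<close> with respect to a tensor is the array of its entrywise partial derivatives.\<close>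

definition tderiv_vanishes :: "nat \<Rightarrow> nat \<Rightarrow> nat \<Rightarrow> (tensor \<Rightarrow> real) \<Rightarrow> tensor \<Rightarrow> bool" where
  "tderiv_vanishes m n p f T \<longleftrightarrow>
     (\<forall>i<m. \<forall>j<n. \<forall>k<p.
        ((\<lambda>x. f (tupdate T i j k x)) has_real_derivative 0) (at (T ! k $$ (i, j))))"

definition lagrange_multiplier ::
  "nat \<Rightarrow> nat \<Rightarrow> nat \<Rightarrow> tensor \<Rightarrow> tensor \<Rightarrow> tensor \<Rightarrow> real \<Rightarrow> tensor \<Rightarrow> tensor \<Rightarrow> real \<Rightarrow> bool" where
  "lagrange_multiplier m n p A B K \<delta> At X \<mu> \<longleftrightarrow>
     tderiv_vanishes m n p (\<lambda>Z. tr_tls_lagrangian A B K \<delta> Z X \<mu>) At \<and>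
     tderiv_vanishes n 1 p (\<lambda>Z. tr_tls_lagrangian A B K \<delta> At Z \<mu>) X"

end

theory Submission
  imports Defs
begin

text \<open>
  Evaluating the tubes of a tensor at a \<open>p\<close>-th root of unity \<open>w\<close> turns the T-product into the
  product of complex matrices, and these evaluations together determine the tensor; the laws of
  tensor arithmetic are thereby inherited from matrices. Since \<open>tkron lamK (tid n p)\<close> becomes a
  scalar matrix at each \<open>w\<close>, multiplying \<open>X\<close> by it from the left amounts to multiplying
  by the tube \<open>lamK\<close> from the right.

  The vanishing derivatives of the Lagrangian say \<open>At = A + R * X\<^sup>\<top>\<close> and \<open>At\<^sup>\<top> * R = \<mu> G\<close> for
  \<open>G = K\<^sup>\<top> * K * X\<close>. With \<open>H = R\<^sup>\<top> * R\<close> and \<open>S = I + X\<^sup>\<top> * X\<close> they give \<open>\<mu> G = A\<^sup>\<top> * R + X * H\<close>,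
  \<open>B = A * X + R * S\<close> and \<open>B\<^sup>\<top> * R = H + \<mu> X\<^sup>\<top> * G\<close>. The last tube is symmetric, so
  \<open>R\<^sup>\<top> * B = B\<^sup>\<top> * R\<close> and \<open>lamI = - H * S\<close>. Both block rows of the claim follow by substitution.
\<close>

subsection \<open>Entries and sizes\<close>

lemma sum_lessThan_add:
  fixes f :: "nat \<Rightarrow> 'a::comm_monoid_add"
  shows "(\<Sum>a<n + s. f a) = (\<Sum>a<n. f a) + (\<Sum>a<s. f (n + a))"
  by (induction s) (simp_all add: add.assoc)

text \<open>The range splits into \<open>p\<close> consecutive intervals of length \<open>m\<close>;
  for \<open>m = 0\<close> both sums vanish. Sums over the rows or columns of \<open>bcirc\<close>
  and \<open>tunfold\<close> thereby become sums over a slice index and an index inside the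
  slice.\<close>

lemma sum_lessThan_mult:
  fixes f :: "nat \<Rightarrow> nat \<Rightarrow> 'a::comm_monoid_add"
  shows "(\<Sum>r<m * p. f (r div m) (r mod m)) = (\<Sum>k<p. \<Sum>a<m. f k a)"
proof (cases "m = 0")
  case False
  have "(\<Sum>r<m * p. f (r div m) (r mod m)) = (\<Sum>k<p. \<Sum>r\<in>{k * m..<k * m + m}. f (r div m) (r mod m))"
    by (simp add: sum.nat_group mult.commute)
  also have "\<dots> = (\<Sum>k<p. \<Sum>a<m. f k a)"
  proof (rule sum.cong[OF refl])
    fix k
    have "(\<Sum>r\<in>{k * m..<k * m + m}. f (r div m) (r mod m))
        = (\<Sum>a<m. f ((a + k * m) div m) ((a + k * m) mod m))"
      using sum.shift_bounds_nat_ivl[of "\<lambda>r. f (r div m) (r mod m)" 0 "k * m" m]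
      by (simp add: add.commute atLeast0LessThan)
    also have "\<dots> = (\<Sum>a<m. f k a)"
      using False by (intro sum.cong) auto
    finally show "(\<Sum>r\<in>{k * m..<k * m + m}. f (r div m) (r mod m)) = (\<Sum>a<m. f k a)" .
  qed
  finally show ?thesis .
qed simp

section \<open>Sizes of tensors and closure under the operations\<close>

lemma tensorsD:
  assumes "T \<in> tensors m n p"
  shows "length T = p" and "k < p \<Longrightarrow> T ! k \<in> carrier_mat m n"
    and "k < p \<Longrightarrow> dim_row (T ! k) = m" and "k < p \<Longrightarrow> dim_col (T ! k) = n"
    and "0 < p \<Longrightarrow> trow T = m" and "0 < p \<Longrightarrow> tcol T = n"
  using assms nth_mem[of _ T]
  by (auto simp: tensors_def trow_def tcol_def hd_conv_nth dest!: subsetD)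

lemma tensorsI:
  assumes "length T = p" and "\<And>k. k < p \<Longrightarrow> T ! k \<in> carrier_mat m n"
  shows "T \<in> tensors m n p"
  using assms by (auto simp: tensors_def in_set_conv_nth)

lemma tensor_eqI:
  assumes "S \<in> tensors m n p" "T \<in> tensors m n p"
    and "\<And>i j k. i < m \<Longrightarrow> j < n \<Longrightarrow> k < p \<Longrightarrow> S ! k $$ (i, j) = T ! k $$ (i, j)"
  shows "S = T"
  using assms by (intro nth_equalityI eq_matI) (auto simp: tensorsD)

lemma tensors_map2:
  assumes "S \<in> tensors m n p" "T \<in> tensors s t p"
    and "\<And>M N. M \<in> carrier_mat m n \<Longrightarrow> N \<in> carrier_mat s t \<Longrightarrow> f M N \<in> carrier_mat u v"
  shows "map2 f S T \<in> tensors u v p"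
  using assms by (intro tensorsI) (auto simp: tensorsD)

lemma tplus_closed: "S \<in> tensors m n p \<Longrightarrow> T \<in> tensors m n p \<Longrightarrow> S +\<^sub>T T \<in> tensors m n p"
  and tminus_closed: "S \<in> tensors m n p \<Longrightarrow> T \<in> tensors m n p \<Longrightarrow> S -\<^sub>T T \<in> tensors m n p"
  and thcat_closed: "S \<in> tensors m n p \<Longrightarrow> U \<in> tensors m s p \<Longrightarrow> thcat S U \<in> tensors m (n + s) p"
  and tvcat_closed: "S \<in> tensors m n p \<Longrightarrow> V \<in> tensors t n p \<Longrightarrow> tvcat S V \<in> tensors (m + t) n p"
  unfolding tplus_def tminus_def thcat_def tvcat_def append_cols_def append_rows_def
  by (erule (1) tensors_map2, auto)+

lemma tuminus_closed: "T \<in> tensors m n p \<Longrightarrow> tuminus T \<in> tensors m n p"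
  and tsmult_closed: "T \<in> tensors m n p \<Longrightarrow> a \<cdot>\<^sub>T T \<in> tensors m n p"
  by (auto simp: tensors_def tuminus_def tsmult_def)

lemma ttranspose_closed: "T \<in> tensors m n p \<Longrightarrow> T\<^sup>\<top> \<in> tensors n m p"
  by (rule tensorsI) (auto simp: ttranspose_def tensorsD)

lemma tid_closed: "tid n p \<in> tensors n n p"
  by (rule tensorsI) (auto simp: tid_def)

lemma tblock_closed:
  "\<lbrakk>P \<in> tensors m n p; Q \<in> tensors m s p; U \<in> tensors t n p; V \<in> tensors t s p\<rbrakk>
    \<Longrightarrow> tblock P Q U V \<in> tensors (m + t) (n + s) p"
  by (simp add: tblock_def tvcat_closed thcat_closed)

lemma tprod_closed:
  assumes "S \<in> tensors m n p" "T \<in> tensors n s p"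
  shows "S *\<^sub>T T \<in> tensors m s p"
\<comment> \<open>For \<open>p = 0\<close> there is no first slice to read sizes from, but the
  product is then the empty list.\<close>
proof (cases "p = 0")
  case False
  then show ?thesis
    using assms
    by (intro tensorsI) (auto simp: tprod_def tfold_def bcirc_def tunfold_def tensorsD Let_def)
qed (use assms in \<open>auto simp: tensors_def tprod_def tfold_def\<close>)

lemmas tensor_closed = tplus_closed tminus_closed thcat_closed tvcat_closed tuminus_closed
  tsmult_closed ttranspose_closed tid_closed tblock_closed tprod_closed

section \<open>Entrywise formulas for the operations\<close>

lemma tensor_index:
  assumes "S \<in> tensors m n p" "k < p" "i < m" "j < n"
  shows "T \<in> tensors m n p \<Longrightarrow> (S +\<^sub>T T) ! k $$ (i, j) = S ! k $$ (i, j) + T ! k $$ (i, j)"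
    and "T \<in> tensors m n p \<Longrightarrow> (S -\<^sub>T T) ! k $$ (i, j) = S ! k $$ (i, j) - T ! k $$ (i, j)"
    and "tuminus S ! k $$ (i, j) = - S ! k $$ (i, j)"
    and "(a \<cdot>\<^sub>T S) ! k $$ (i, j) = a * S ! k $$ (i, j)"
  using assms by (simp_all add: tplus_def tminus_def tuminus_def tsmult_def tensorsD)

lemma ttranspose_index:
  assumes "T \<in> tensors m n p" "k < p" "i < n" "j < m"
  shows "T\<^sup>\<top> ! k $$ (i, j) = T ! ((p - k) mod p) $$ (j, i)"
  using assms by (auto simp: ttranspose_def tensorsD)

lemma tid_index:
  assumes "k < p" "i < n" "j < n"
  shows "tid n p ! k $$ (i, j) = (if k = 0 \<and> i = j then 1 else 0)"
  using assms by (auto simp: tid_def)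

lemma thcat_index:
  assumes "S \<in> tensors m n p" "T \<in> tensors m s p" "k < p" "i < m" "j < n + s"
  shows "thcat S T ! k $$ (i, j) = (if j < n then S ! k $$ (i, j) else T ! k $$ (i, j - n))"
  using assms by (simp add: thcat_def append_cols_def tensorsD)

lemma tvcat_index:
  assumes "S \<in> tensors m n p" "T \<in> tensors t n p" "k < p" "i < m + t" "j < n"
  shows "tvcat S T ! k $$ (i, j) = (if i < m then S ! k $$ (i, j) else T ! k $$ (i - m, j))"
  using assms by (simp add: tvcat_def append_rows_def tensorsD)

text \<open>The T-product is the circular convolution of the slices. As in \<open>bcirc\<close>, the
  summand \<open>p\<close> keeps \<open>k - l\<close> from truncating.\<close>

lemma tprod_index:
  assumes "S \<in> tensors m n p" "T \<in> tensors n s p" "k < p" "i < m" "j < s"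
  shows "(S *\<^sub>T T) ! k $$ (i, j)
    = (\<Sum>l<p. \<Sum>a<n. S ! ((p + k - l) mod p) $$ (i, a) * T ! l $$ (a, j))"
proof -
  have p: "0 < p" using assms by simp
  have r: "k * m + i < m * p"
    using assms mult_le_mono1[of "Suc k" p m] by (simp add: mult.commute)
  have "(S *\<^sub>T T) ! k $$ (i, j) = (bcirc S * tunfold T) $$ (k * m + i, j)"
    using assms p by (simp add: tprod_def tfold_def tensorsD bcirc_def tunfold_def Let_def)
  also have "\<dots> = (\<Sum>c<n * p. S ! ((p + k - c div n) mod p) $$ (i, c mod n) * T ! (c div n) $$ (c mod n, j))"
    using assms p r
    by (simp add: scalar_prod_def bcirc_def tunfold_def tensorsD Let_def atLeast0LessThan)
  also have "\<dots> = (\<Sum>l<p. \<Sum>a<n. S ! ((p + k - l) mod p) $$ (i, a) * T ! l $$ (a, j))"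
    by (rule sum_lessThan_mult)
  finally show ?thesis .
qed

subsection \<open>Evaluation at roots of unity\<close>

text \<open>The slices serve as coefficients of a matrix polynomial in \<open>w\<close>. At
  \<open>w = dft_root p ^ k\<close> its value is the \<open>k\<close>-th Fourier block; leaving
  \<open>w\<close> free allows \<open>inverse w\<close> to appear for transposes.\<close>

definition tdft :: "complex \<Rightarrow> tensor \<Rightarrow> complex mat" where
  "tdft w T = mat (trow T) (tcol T)
     (\<lambda>(i, j). \<Sum>l<length T. w ^ l * complex_of_real (T ! l $$ (i, j)))"

definition dft_root :: "nat \<Rightarrow> complex" where
  "dft_root p = exp (- 2 * of_real pi * \<i> / of_nat p)"

text \<open>The conjugate accounts for the minus sign in the exponent and gives access to the facts
  about \<open>cis\<close> and roots of unity.\<close>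

lemma dft_root_conv: "dft_root p = cnj (cis (2 * pi / p))"
  unfolding cis_cnj unfolding dft_root_def cis_conv_exp by (simp add: mult_ac)

lemma dft_root_power_eq_1: "0 < p \<Longrightarrow> dft_root p ^ p = 1"
  by (simp add: dft_root_conv Complex.DeMoivre flip: complex_cnj_power)

lemma dft_root_power_power_eq_1: "0 < p \<Longrightarrow> (dft_root p ^ k) ^ p = 1"
  by (metis dft_root_power_eq_1 mult.commute power_mult power_one)

lemma cnj_dft_root: "cnj (dft_root p) = inverse (dft_root p)"
  by (simp add: dft_root_conv cis_cnj)

text \<open>The points \<open>cis (2 * pi * k / p)\<close> with \<open>k < p\<close> are distinct,
  so only \<open>k = 0\<close> yields \<open>1\<close>.\<close>

lemma dft_root_power_neq_1:
  assumes "0 < j" "j < p"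
  shows "dft_root p ^ j \<noteq> 1"
proof
  assume "dft_root p ^ j = 1"
  then have "cis (2 * pi * real j / real p) = cis (2 * pi * real 0 / real p)"
    by (simp add: dft_root_conv Complex.DeMoivre mult_ac flip: complex_cnj_power)
  moreover have "inj_on (\<lambda>k. cis (2 * pi * real k / real p)) {..<p}"
    using bij_betw_roots_unity[of p] assms by (auto simp: bij_betw_def)
  ultimately show False
    using assms inj_onD[of "\<lambda>k. cis (2 * pi * real k / real p)" "{..<p}" j 0] by simp
qed

text \<open>The summands are powers of \<open>z\<close>, the quotient of the \<open>i\<close>-th and
  the \<open>j\<close>-th power of the root. Since \<open>z ^ p = 1\<close>, the geometric sum
  vanishes unless \<open>z = 1\<close>.\<close>

lemma sum_dft_root_orthogonal:
  assumes "i < p" "j < p"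
  shows "(\<Sum>k<p. dft_root p ^ (k * i) * cnj (dft_root p ^ (k * j))) = (if i = j then of_nat p else 0)"
proof -
  let ?w = "dft_root p"
  have w0: "?w \<noteq> 0" by (simp add: dft_root_def)
  define z where "z = ?w ^ i / ?w ^ j"
  have "(\<Sum>k<p. ?w ^ (k * i) * cnj (?w ^ (k * j))) = (\<Sum>k<p. z ^ k)"
    by (intro sum.cong)
      (simp_all add: z_def cnj_dft_root power_mult_distrib power_inverse divide_inverse mult.commute
        flip: power_mult)
  also have "\<dots> = (if i = j then of_nat p else 0)"
  proof (cases "i = j")
    case False
    have "z \<noteq> 1"
    proof
      assume "z = 1"
      then have eq: "?w ^ i = ?w ^ j" using w0 by (simp add: z_def)
      \<comment> \<open>The maximum and minimum avoid a case split on which exponent is larger,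
        natural subtraction being truncated.\<close>
      then have "?w ^ (max i j - min i j) = 1"
        using w0 by (simp add: power_diff max_def min_def)
      then show False
        using dft_root_power_neq_1[of "max i j - min i j" p] False assms by auto
    qed
    moreover have "z ^ p = 1"
      using dft_root_power_eq_1[of p] assms
      by (simp add: z_def power_divide power_mult[symmetric] mult.commute[of _ p] power_mult)
    ultimately show ?thesis
      using False by (simp add: geometric_sum)
  qed (use w0 in \<open>simp add: z_def\<close>)
  finally show ?thesis .
qed

lemma power_mod_root_of_unity:
  fixes w :: "'a::monoid_mult"
  assumes "w ^ p = 1"
  shows "w ^ (k mod p) = w ^ k"
proof -
  have "w ^ k = w ^ (p * (k div p) + k mod p)" by simp
  also have "\<dots> = w ^ (k mod p)" using assms by (simp only: power_add power_mult) simp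
  finally show ?thesis by simp
qed

context
  fixes p :: nat
  assumes p: "0 < p"
begin

lemma tdft_carrier: "T \<in> tensors m n p \<Longrightarrow> tdft w T \<in> carrier_mat m n"
  using p by (simp add: tdft_def tensorsD)

lemma tdft_dim:
  assumes "T \<in> tensors m n p"
  shows "dim_row (tdft w T) = m" "dim_col (tdft w T) = n"
  using tdft_carrier[OF assms] by auto

lemma tdft_index:
  "\<lbrakk>T \<in> tensors m n p; i < m; j < n\<rbrakk>
    \<Longrightarrow> tdft w T $$ (i, j) = (\<Sum>l<p. w ^ l * complex_of_real (T ! l $$ (i, j)))"
  using p by (simp add: tdft_def tensorsD)

text \<open>Fourier inversion: after exchanging the sums, orthogonality leaves only slice
  \<open>l\<close>. The factor \<open>p\<close> stays on the right because \<open>tdft\<close> is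
  not normalised.\<close>

lemma inverse_dft:
  assumes "T \<in> tensors m n p" "l < p" "i < m" "j < n"
  shows "(\<Sum>k<p. cnj (dft_root p ^ (k * l)) * tdft (dft_root p ^ k) T $$ (i, j))
    = of_nat p * complex_of_real (T ! l $$ (i, j))"
proof -
  let ?w = "dft_root p" and ?t = "\<lambda>l. complex_of_real (T ! l $$ (i, j))"
  have "(\<Sum>k<p. cnj (?w ^ (k * l)) * tdft (?w ^ k) T $$ (i, j))
    = (\<Sum>k<p. \<Sum>l'<p. ?w ^ (k * l') * cnj (?w ^ (k * l)) * ?t l')"
    using assms by (simp add: tdft_index sum_distrib_left power_mult mult_ac)
  also have "\<dots> = (\<Sum>l'<p. (\<Sum>k<p. ?w ^ (k * l') * cnj (?w ^ (k * l))) * ?t l')"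
    by (subst sum.swap) (simp only: sum_distrib_right)
  also have "\<dots> = (\<Sum>l'<p. if l' = l then of_nat p * ?t l' else 0)"
    using assms by (intro sum.cong) (auto simp: sum_dft_root_orthogonal simp del: complex_cnj_power)
  also have "\<dots> = of_nat p * ?t l"
    using assms by (simp add: sum.delta)
  finally show ?thesis .
qed

text \<open>Fourier inversion recovers every entry from the values at the powers of
  \<open>dft_root p\<close>. This is how matrix laws are transported to tensors below.\<close>

lemma tensor_eqI_tdft:
  assumes S: "S \<in> tensors m n p" and T: "T \<in> tensors m n p"
    and eq: "\<And>w. w ^ p = 1 \<Longrightarrow> tdft w S = tdft w T"
  shows "S = T"
proof (rule tensor_eqI[OF S T])
  fix i j k assume *: "i < m" "j < n" "k < p"
  have "tdft (dft_root p ^ l) S = tdft (dft_root p ^ l) T" for l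
    by (rule eq) (rule dft_root_power_power_eq_1[OF p])
  then have "of_nat p * complex_of_real (S ! k $$ (i, j)) = of_nat p * complex_of_real (T ! k $$ (i, j))"
    by (simp add: inverse_dft[OF S, symmetric] inverse_dft[OF T, symmetric] * del: complex_cnj_power)
  then show "S ! k $$ (i, j) = T ! k $$ (i, j)"
    using p by simp
qed

text \<open>A cyclic shift permutes the indices; its inverse is the shift by \<open>l\<close> in the
  other direction.\<close>

lemma sum_mod_shift:
  fixes f :: "nat \<Rightarrow> 'a::comm_monoid_add"
  assumes "l < p"
  shows "(\<Sum>k<p. f ((p + k - l) mod p)) = sum f {..<p}"
proof (rule sum.reindex_bij_witness[of _ "\<lambda>k. (k + l) mod p" "\<lambda>k. (p + k - l) mod p"])
  fix k assume "k \<in> {..<p}"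
  then have k: "k < p" by simp
  show "((p + k - l) mod p + l) mod p = k"
    using k assms by (simp add: mod_add_left_eq)
  show "(p + (k + l) mod p - l) mod p = k"
    using k assms by (cases "k + l < p") (simp_all add: mod_if[of "k + l"])
qed (use p in auto)

section \<open>Evaluation as a homomorphism to complex matrices\<close>

lemma tdft_tplus:
  assumes "S \<in> tensors m n p" "T \<in> tensors m n p"
  shows "tdft w (S +\<^sub>T T) = tdft w S + tdft w T"
  using assms tplus_closed[OF assms]
  by (intro eq_matI) (simp_all add: tdft_dim tdft_index tensor_index distrib_left sum.distrib)

lemma tdft_tsmult:
  assumes "T \<in> tensors m n p"
  shows "tdft w (a \<cdot>\<^sub>T T) = complex_of_real a \<cdot>\<^sub>m tdft w T"
  using assms tsmult_closed[OF assms, of a]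
  by (intro eq_matI) (simp_all add: tdft_dim tdft_index tensor_index sum_distrib_left mult_ac)

lemma tdft_tid: "tdft w (tid n p) = 1\<^sub>m n"
proof (rule eq_matI)
  fix i j assume "i < dim_row (1\<^sub>m n)" "j < dim_col (1\<^sub>m n)"
  then have ij: "i < n" "j < n" by auto
  have "tdft w (tid n p) $$ (i, j) = (\<Sum>l<p. if l = 0 then if i = j then 1 else 0 else 0)"
    unfolding tdft_index[OF tid_closed ij] using ij by (intro sum.cong) (auto simp: tid_index)
  then show "tdft w (tid n p) $$ (i, j) = 1\<^sub>m n $$ (i, j)"
    using p ij by simp
qed (simp_all add: tdft_dim[OF tid_closed])

text \<open>Slice \<open>l\<close> of the transpose comes from slice \<open>p - l\<close>, and
  \<open>w ^ (p - l) = inverse w ^ l\<close>. So the evaluation point is inverted while the matrix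
  is transposed without conjugation.\<close>

lemma tdft_ttranspose:
  assumes T: "T \<in> tensors m n p" and w: "w ^ p = 1"
  shows "tdft w (T\<^sup>\<top>) = transpose_mat (tdft (inverse w) T)"
proof (rule eq_matI)
  fix i j assume "i < dim_row (transpose_mat (tdft (inverse w) T))"
    "j < dim_col (transpose_mat (tdft (inverse w) T))"
  then have ij: "i < n" "j < m" by (auto simp: tdft_dim[OF T])
  let ?t = "\<lambda>l. complex_of_real (T ! l $$ (j, i))"
  have w0: "w \<noteq> 0" using w p by (auto simp: power_0_left)
  have "tdft w (T\<^sup>\<top>) $$ (i, j) = (\<Sum>l<p. w ^ l * ?t ((p - l) mod p))"
    using ij T by (simp add: tdft_index[OF ttranspose_closed[OF T]] ttranspose_index)
  also have "\<dots> = (\<Sum>l<p. inverse w ^ l * ?t l)"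
  proof (rule sum.reindex_bij_witness[of _ "\<lambda>k. (p - k) mod p" "\<lambda>k. (p - k) mod p"])
    fix l assume "l \<in> {..<p}"
    then have l: "l < p" by simp
    then show "(p - (p - l) mod p) mod p = l" "(p - (p - l) mod p) mod p = l"
      by (cases "l = 0", simp_all)+
    have "inverse w ^ ((p - l) mod p) = inverse w ^ (p - l)"
      using w by (intro power_mod_root_of_unity) (simp add: power_inverse)
    also have "\<dots> = w ^ l"
      using w w0 l by (simp add: power_inverse power_diff)
    finally show "inverse w ^ ((p - l) mod p) * ?t ((p - l) mod p) = w ^ l * ?t ((p - l) mod p)"
      by simp
  qed (use p in auto)
  finally show "tdft w (T\<^sup>\<top>) $$ (i, j) = transpose_mat (tdft (inverse w) T) $$ (i, j)"
    using ij T by (simp add: tdft_index tdft_dim)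
qed (simp_all add: tdft_dim[OF T] tdft_dim[OF ttranspose_closed[OF T]])

text \<open>The convolution theorem: circular convolution is polynomial multiplication with
  exponents modulo \<open>p\<close>, which \<open>w ^ p = 1\<close> makes invisible at
  \<open>w\<close>.\<close>

lemma tdft_tprod:
  assumes S: "S \<in> tensors m n p" and T: "T \<in> tensors n s p" and w: "w ^ p = 1"
  shows "tdft w (S *\<^sub>T T) = tdft w S * tdft w T"
proof (rule eq_matI)
  fix i j assume "i < dim_row (tdft w S * tdft w T)" "j < dim_col (tdft w S * tdft w T)"
  then have ij: "i < m" "j < s" by (auto simp: tdft_dim[OF S] tdft_dim[OF T])
  let ?s = "\<lambda>k a. complex_of_real (S ! k $$ (i, a))" and ?t = "\<lambda>l a. complex_of_real (T ! l $$ (a, j))"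
  \<comment> \<open>This splits the power between the two factors, so that for fixed
    \<open>l\<close> the summand depends on \<open>k\<close> only through the shifted index and the
    shift can be undone.\<close>
  have pow: "w ^ k = w ^ ((p + k - l) mod p) * w ^ l" if "l < p" for k l
  proof -
    have "w ^ ((p + k - l) mod p) * w ^ l = w ^ (p + k - l + l)"
      by (simp only: power_mod_root_of_unity[OF w] power_add)
    also have "\<dots> = w ^ k" using that w by (simp add: power_add)
    finally show ?thesis by simp
  qed
  have "tdft w (S *\<^sub>T T) $$ (i, j)
      = (\<Sum>k<p. \<Sum>l<p. \<Sum>a<n. w ^ k * (?s ((p + k - l) mod p) a * ?t l a))"
    using ij by (simp add: tdft_index[OF tprod_closed[OF S T]] tprod_index[OF S T] sum_distrib_left)
  also have "\<dots> = (\<Sum>l<p. \<Sum>k<p. \<Sum>a<n. w ^ k * (?s ((p + k - l) mod p) a * ?t l a))"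
    by (rule sum.swap)
  also have "\<dots> = (\<Sum>l<p. \<Sum>k<p. \<Sum>a<n. w ^ ((p + k - l) mod p) * ?s ((p + k - l) mod p) a * (w ^ l * ?t l a))"
    by (intro sum.cong refl) (subst pow, auto)
  also have "\<dots> = (\<Sum>l<p. \<Sum>k<p. \<Sum>a<n. w ^ k * ?s k a * (w ^ l * ?t l a))"
  proof (rule sum.cong[OF refl])
    fix l assume "l \<in> {..<p}"
    then show "(\<Sum>k<p. \<Sum>a<n. w ^ ((p + k - l) mod p) * ?s ((p + k - l) mod p) a * (w ^ l * ?t l a))
        = (\<Sum>k<p. \<Sum>a<n. w ^ k * ?s k a * (w ^ l * ?t l a))"
      using sum_mod_shift[of l "\<lambda>k. \<Sum>a<n. w ^ k * ?s k a * (w ^ l * ?t l a)"] by simp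
  qed
  also have "\<dots> = (\<Sum>l<p. \<Sum>a<n. \<Sum>k<p. w ^ k * ?s k a * (w ^ l * ?t l a))"
    by (intro sum.cong refl sum.swap)
  also have "\<dots> = (\<Sum>a<n. \<Sum>l<p. \<Sum>k<p. w ^ k * ?s k a * (w ^ l * ?t l a))"
    by (rule sum.swap)
  also have "\<dots> = (\<Sum>a<n. (\<Sum>k<p. w ^ k * ?s k a) * (\<Sum>l<p. w ^ l * ?t l a))"
    by (rule sum.cong[OF refl], subst sum.swap) (simp only: sum_product)
  also have "\<dots> = (tdft w S * tdft w T) $$ (i, j)"
    using ij S T by (simp add: scalar_prod_def tdft_dim tdft_index atLeast0LessThan)
  finally show "tdft w (S *\<^sub>T T) $$ (i, j) = (tdft w S * tdft w T) $$ (i, j)" .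
qed (simp_all add: tdft_dim[OF S] tdft_dim[OF T] tdft_dim[OF tprod_closed[OF S T]])

end

subsection \<open>Fourier blocks and the Kronecker product\<close>

text \<open>Induction on the list: beyond the first block, removing it lowers both quotients by one
  and keeps both remainders.\<close>

lemma diag_block_mat_index:
  assumes "set Ds \<subseteq> carrier_mat m n" "r < m * length Ds" "c < n * length Ds"
  shows "diag_block_mat Ds $$ (r, c)
    = (if r div m = c div n then Ds ! (r div m) $$ (r mod m, c mod n) else 0)"
  using assms
proof (induction Ds arbitrary: r c)
  case (Cons D Ds)
  have D: "dim_row D = m" "dim_col D = n" using Cons.prems by auto
  have dim: "dim_row (diag_block_mat Ds) = m * length Ds" "dim_col (diag_block_mat Ds) = n * length Ds"
  proof -
    have len: "map dim_row Ds = map (\<lambda>_. m) Ds" "map dim_col Ds = map (\<lambda>_. n) Ds"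
      using Cons.prems by auto
    show "dim_row (diag_block_mat Ds) = m * length Ds" "dim_col (diag_block_mat Ds) = n * length Ds"
      by (simp_all add: dim_diag_block_mat len sum_list_triv)
  qed
  \<comment> \<open>An index in range excludes empty blocks, so \<open>div\<close> and
    \<open>mod\<close> carry their usual meaning.\<close>
  have m0: "0 < m" "0 < n" using Cons.prems by (auto intro: gr0I)
  have eq: "diag_block_mat (D # Ds) $$ (r, c) =
      (if r < m then if c < n then D $$ (r, c) else 0
       else if c < n then 0 else diag_block_mat Ds $$ (r - m, c - n))"
    using Cons.prems by (simp add: Let_def D dim)
  have IH: "diag_block_mat Ds $$ (r - m, c - n) = (if (r - m) div m = (c - n) div n
      then Ds ! ((r - m) div m) $$ ((r - m) mod m, (c - n) mod n) else 0)"
    if "m \<le> r" "n \<le> c"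
    using Cons.prems that by (intro Cons.IH) auto
  show ?case
    unfolding eq using IH m0
    by (auto simp: le_div_geq le_mod_geq not_less div_eq_0_iff nth_Cons split: nat.splits)
qed simp

lemma mat_kron_dim [simp]:
  "dim_row (mat_kron A B) = dim_row A * dim_row B" "dim_col (mat_kron A B) = dim_col A * dim_col B"
  by (simp_all add: mat_kron_def)

lemma mat_kron_index:
  "i < dim_row A * dim_row B \<Longrightarrow> j < dim_col A * dim_col B \<Longrightarrow> mat_kron A B $$ (i, j) =
    A $$ (i div dim_row B, j div dim_col B) * B $$ (i mod dim_row B, j mod dim_col B)"
  by (simp add: mat_kron_def)

lemma dft_mat_conv: "dft_mat p = mat p p (\<lambda>(i, j). dft_root p ^ (i * j) / of_real (sqrt (real p)))"
  by (simp add: dft_mat_def dft_root_def)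

lemma adjoint_dft_mat_index:
  "i < p \<Longrightarrow> j < p \<Longrightarrow>
    mat_adjoint (dft_mat p) $$ (i, j) = cnj (dft_root p ^ (j * i)) / of_real (sqrt (real p))"
  by (simp add: mat_adjoint_def dft_mat_conv mat_of_rows_index conjugate_complex_def)

lemma dft_mat_dim:
  "dim_row (dft_mat p) = p" "dim_col (dft_mat p) = p"
  "dim_row (mat_adjoint (dft_mat p)) = p" "dim_col (mat_adjoint (dft_mat p)) = p"
  by (simp_all add: mat_adjoint_def dft_mat_conv)

text \<open>The Kronecker factors with an identity act only on block indices, so every block is a
  combination of the \<open>Ds ! k\<close> with Fourier coefficients. The two normalisations by the
  square root of \<open>p\<close> combine to \<open>1 / p\<close>.\<close>

lemma dft_conjugation_index:
  assumes Ds: "set Ds \<subseteq> carrier_mat m n" "length Ds = p" and r: "r < m * p" and c: "c < n * p"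
  shows "(mat_kron (mat_adjoint (dft_mat p)) (1\<^sub>m m) * diag_block_mat Ds * mat_kron (dft_mat p) (1\<^sub>m n)) $$ (r, c)
    = (\<Sum>k<p. cnj (dft_root p ^ (k * (r div m))) * dft_root p ^ (k * (c div n))
        * Ds ! k $$ (r mod m, c mod n)) / of_nat p"
    (is "(?P * ?D * ?Q) $$ _ = _")
proof -
  let ?w = "dft_root p" and ?s = "complex_of_real (sqrt (real p))"
  have m0: "0 < m" "0 < n" "0 < p" using r c by (auto intro: gr0I)
  have s: "?s * ?s = of_nat p" by (simp flip: of_real_mult)
  have len: "map dim_row Ds = map (\<lambda>_. m) Ds" "map dim_col Ds = map (\<lambda>_. n) Ds"
    using Ds by auto
  have dim: "dim_row ?D = m * p" "dim_col ?D = n * p"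
    by (simp_all add: dim_diag_block_mat len sum_list_triv Ds)
  have rm: "r div m < p" "r mod m < m" "c div n < p" "c mod n < n"
    using r c m0 by (simp_all add: less_mult_imp_div_less mult.commute)
  \<comment> \<open>The identity factor fixes the inner row and the block diagonal fixes the block
    index, so a single summand survives.\<close>
  have PD: "(?P * ?D) $$ (r, c') = cnj (?w ^ (c' div n * (r div m))) / ?s * Ds ! (c' div n) $$ (r mod m, c' mod n)"
    if c': "c' < n * p" for c'
  proof -
    have "c' div n < p" using c' by (simp add: less_mult_imp_div_less mult.commute)
    have "(?P * ?D) $$ (r, c') = (\<Sum>s<m * p. ?P $$ (r, s) * ?D $$ (s, c'))"
      using r c' by (simp add: scalar_prod_def atLeast0LessThan dim dft_mat_dim mult.commute[of p])
    \<comment> \<open>The explicit abstraction over block index and inner index gives the summand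
      the shape that \<open>sum_lessThan_mult\<close> expects.\<close>
    also have "\<dots> = (\<Sum>s<m * p. (\<lambda>k a. cnj (?w ^ (k * (r div m))) / ?s * (if r mod m = a then 1 else 0)
        * (if k = c' div n then Ds ! k $$ (a, c' mod n) else 0)) (s div m) (s mod m))"
    proof (rule sum.cong[OF refl])
      fix s assume "s \<in> {..<m * p}"
      then have s: "s < m * p" "s div m < p" by (simp_all add: less_mult_imp_div_less mult.commute)
      show "?P $$ (r, s) * ?D $$ (s, c') = (\<lambda>k a. cnj (?w ^ (k * (r div m))) / ?s * (if r mod m = a then 1 else 0)
        * (if k = c' div n then Ds ! k $$ (a, c' mod n) else 0)) (s div m) (s mod m)"
        using s r c' rm m0 diag_block_mat_index[OF Ds(1), of s c'] Ds(2)
        by (simp add: mat_kron_index dft_mat_dim adjoint_dft_mat_index mult.commute[of p])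
    qed
    also have "\<dots> = (\<Sum>k<p. \<Sum>a<m. cnj (?w ^ (k * (r div m))) / ?s * (if r mod m = a then 1 else 0)
        * (if k = c' div n then Ds ! k $$ (a, c' mod n) else 0))"
      by (rule sum_lessThan_mult)
    also have "\<dots> = (\<Sum>k<p. \<Sum>a<m. if a = r mod m then if k = c' div n then
        cnj (?w ^ (k * (r div m))) / ?s * Ds ! k $$ (a, c' mod n) else 0 else 0)"
      by (intro sum.cong) auto
    also have "\<dots> = cnj (?w ^ (c' div n * (r div m))) / ?s * Ds ! (c' div n) $$ (r mod m, c' mod n)"
      using rm \<open>c' div n < p\<close> by (simp add: sum.delta)
    finally show ?thesis .
  qed
  have "(?P * ?D * ?Q) $$ (r, c) = (\<Sum>c'<n * p. (?P * ?D) $$ (r, c') * ?Q $$ (c', c))"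
    using r c by (simp add: scalar_prod_def atLeast0LessThan dim dft_mat_dim mult.commute[of p])
  also have "\<dots> = (\<Sum>c'<n * p. (\<lambda>k b. cnj (?w ^ (k * (r div m))) / ?s * Ds ! k $$ (r mod m, b)
      * (?w ^ (k * (c div n)) / ?s * (if b = c mod n then 1 else 0))) (c' div n) (c' mod n))"
  proof (rule sum.cong[OF refl])
    fix c' assume "c' \<in> {..<n * p}"
    then have c': "c' < n * p" "c' div n < p" by (simp_all add: less_mult_imp_div_less mult.commute)
    show "(?P * ?D) $$ (r, c') * ?Q $$ (c', c) = (\<lambda>k b. cnj (?w ^ (k * (r div m))) / ?s * Ds ! k $$ (r mod m, b)
      * (?w ^ (k * (c div n)) / ?s * (if b = c mod n then 1 else 0))) (c' div n) (c' mod n)"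
      using c' c rm m0 unfolding PD[OF c'(1)]
      by (simp add: mat_kron_index dft_mat_conv mult.commute[of p])
  qed
  also have "\<dots> = (\<Sum>k<p. \<Sum>b<n. cnj (?w ^ (k * (r div m))) / ?s * Ds ! k $$ (r mod m, b)
      * (?w ^ (k * (c div n)) / ?s * (if b = c mod n then 1 else 0)))"
    by (rule sum_lessThan_mult)
  also have "\<dots> = (\<Sum>k<p. \<Sum>b<n. if b = c mod n then cnj (?w ^ (k * (r div m))) * ?w ^ (k * (c div n))
      * Ds ! k $$ (r mod m, b) / (?s * ?s) else 0)"
    by (intro sum.cong) (auto simp: mult_ac)
  also have "\<dots> = (\<Sum>k<p. cnj (?w ^ (k * (r div m))) * ?w ^ (k * (c div n))
      * Ds ! k $$ (r mod m, c mod n)) / of_nat p"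
    using rm unfolding s by (simp add: sum.delta sum_divide_distrib)
  finally show ?thesis .
qed

section \<open>Fourier blocks as evaluations of the tensor\<close>

context
  fixes p :: nat
  assumes p: "0 < p"
begin

text \<open>Both sides of the block diagonalization are block circulant, so comparing them amounts
  to comparing their first block columns.\<close>

lemma fourier_blocks_iff_inverse_dft:
  assumes T: "T \<in> tensors m n p"
  shows "fourier_blocks m n p T Ds \<longleftrightarrow> length Ds = p \<and> set Ds \<subseteq> carrier_mat m n \<and>
    (\<forall>l<p. \<forall>i<m. \<forall>j<n. of_nat p * complex_of_real (T ! l $$ (i, j))
       = (\<Sum>k<p. cnj (dft_root p ^ (k * l)) * Ds ! k $$ (i, j)))" (is "_ \<longleftrightarrow> _ \<and> _ \<and> ?inv")
proof -
  let ?w = "dft_root p"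
  have "map_mat complex_of_real (bcirc T) =
      mat_kron (mat_adjoint (dft_mat p)) (1\<^sub>m m) * diag_block_mat Ds * mat_kron (dft_mat p) (1\<^sub>m n)
      \<longleftrightarrow> ?inv" (is "?L = ?R \<longleftrightarrow> _") if Ds: "length Ds = p" "set Ds \<subseteq> carrier_mat m n"
  proof -
    have dim: "dim_row ?L = m * p" "dim_col ?L = n * p" "dim_row ?R = m * p" "dim_col ?R = n * p"
      using tensorsD[OF T] p by (simp_all add: bcirc_def dft_mat_dim mult.commute)
    have L: "?L $$ (r, c) = complex_of_real (T ! ((p + r div m - c div n) mod p) $$ (r mod m, c mod n))"
      if "r < m * p" "c < n * p" for r c
      using that tensorsD[OF T] p by (simp add: bcirc_def)
    note R = dft_conjugation_index[OF Ds(2,1)]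
    show ?thesis
    proof
      assume eq: "?L = ?R"
      show ?inv
      proof (intro allI impI)
        fix l i j assume *: "l < p" "i < m" "j < n"
        \<comment> \<open>Row \<open>l * m + i\<close> and column \<open>j\<close> address entry
          \<open>(i, j)\<close> of block row \<open>l\<close> in the first block column, where
          \<open>bcirc\<close> holds slice \<open>l\<close>.\<close>
        have "l * m + i < m * p"
          using * mult_le_mono1[of "Suc l" p m] by (simp add: mult.commute)
        moreover have "j < n * p" using * p by (metis less_le_trans mult.right_neutral mult_le_mono2 Suc_leI One_nat_def)
        ultimately have rc: "l * m + i < m * p" "j < n * p" by simp_all
        have "complex_of_real (T ! l $$ (i, j)) = ?L $$ (l * m + i, j)"
          using * by (simp add: L[OF rc])
        also have "\<dots> = (\<Sum>k<p. cnj (?w ^ (k * l)) * Ds ! k $$ (i, j)) / of_nat p"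
          unfolding eq R[OF rc] using * by simp
        finally have "complex_of_real (T ! l $$ (i, j))
            = (\<Sum>k<p. cnj (?w ^ (k * l)) * Ds ! k $$ (i, j)) / of_nat p" .
        then show "of_nat p * complex_of_real (T ! l $$ (i, j))
            = (\<Sum>k<p. cnj (?w ^ (k * l)) * Ds ! k $$ (i, j))"
          using p by simp
      qed
    next
      assume inv: ?inv
      show "?L = ?R"
      proof (rule eq_matI, unfold dim)
        fix r c assume rc: "r < m * p" "c < n * p"
        then have m0: "0 < m" "0 < n" by (auto intro: gr0I)
        define i where "i = r div m"
        define j where "j = c div n"
        \<comment> \<open>The slice found in block \<open>(i, j)\<close> of
          \<open>bcirc T\<close>.\<close>
        define l where "l = (p + i - j) mod p"
        have ij: "i < p" "j < p" "l < p"
          using rc p by (simp_all add: i_def j_def l_def less_mult_imp_div_less mult.commute)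
        have "cnj (?w ^ (k * l)) = cnj (?w ^ (k * i)) * ?w ^ (k * j)" for k
        proof -
          have w: "?w \<noteq> 0" by (simp add: dft_root_def)
          have "?w ^ (k * l) * ?w ^ (k * j) = ?w ^ (k * (p + i - j)) * ?w ^ (k * j)"
          proof -
            show ?thesis unfolding l_def power_mult
              by (simp add: power_mod_root_of_unity dft_root_power_power_eq_1[OF p])
          qed
          also have "\<dots> = ?w ^ (p * k) * ?w ^ (k * i)"
            using ij by (simp flip: power_add distrib_left add: mult.commute[of p])
          also have "\<dots> = ?w ^ (k * i)" using dft_root_power_eq_1[OF p] by (simp add: power_mult)
          finally have "?w ^ (k * l) = ?w ^ (k * i) * inverse (?w ^ (k * j))"
            using w by (simp add: field_simps)
          then show ?thesis by (simp add: cnj_dft_root power_inverse)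
        qed
        then have "of_nat p * complex_of_real (T ! l $$ (r mod m, c mod n))
            = (\<Sum>k<p. cnj (?w ^ (k * i)) * ?w ^ (k * j) * Ds ! k $$ (r mod m, c mod n))"
          using inv ij(3) m0 by simp
        then show "?L $$ (r, c) = ?R $$ (r, c)"
          using p by (simp add: L[OF rc] R[OF rc] field_simps i_def j_def l_def)
      qed simp_all
    qed
  qed
  then show ?thesis unfolding fourier_blocks_def by blast
qed

text \<open>Orthogonality inverts the system of the previous lemma, which makes the blocks unique;
  conversely, the evaluations solve it by \<open>inverse_dft\<close>.\<close>

lemma fourier_blocks_iff_tdft:
  assumes T: "T \<in> tensors m n p"
  shows "fourier_blocks m n p T Ds \<longleftrightarrow> Ds = map (\<lambda>k. tdft (dft_root p ^ k) T) [0..<p]"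
proof
  let ?w = "dft_root p"
  assume "fourier_blocks m n p T Ds"
  then have Ds: "length Ds = p" "set Ds \<subseteq> carrier_mat m n"
    and inv: "\<And>l i j. l < p \<Longrightarrow> i < m \<Longrightarrow> j < n \<Longrightarrow> of_nat p * complex_of_real (T ! l $$ (i, j))
       = (\<Sum>k<p. cnj (?w ^ (k * l)) * Ds ! k $$ (i, j))"
    by (auto simp: fourier_blocks_iff_inverse_dft[OF T])
  have dim: "Ds ! k \<in> carrier_mat m n" if "k < p" for k using that Ds by auto
  have "Ds ! k = tdft (?w ^ k) T" if k: "k < p" for k
  proof (rule eq_matI, unfold tdft_dim[OF p T])
    fix i j assume ij: "i < m" "j < n"
    have "of_nat p * tdft (?w ^ k) T $$ (i, j)
        = (\<Sum>l<p. ?w ^ (k * l) * (of_nat p * complex_of_real (T ! l $$ (i, j))))"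
      using ij by (simp add: tdft_index[OF p T] sum_distrib_left mult_ac flip: power_mult)
    also have "\<dots> = (\<Sum>l<p. ?w ^ (k * l) * (\<Sum>k'<p. cnj (?w ^ (k' * l)) * Ds ! k' $$ (i, j)))"
      using ij by (intro sum.cong) (simp_all add: inv del: complex_cnj_power)
    also have "\<dots> = (\<Sum>l<p. \<Sum>k'<p. ?w ^ (l * k) * cnj (?w ^ (l * k')) * Ds ! k' $$ (i, j))"
      by (simp add: sum_distrib_left mult_ac)
    also have "\<dots> = (\<Sum>k'<p. (\<Sum>l<p. ?w ^ (l * k) * cnj (?w ^ (l * k'))) * Ds ! k' $$ (i, j))"
      by (subst sum.swap) (simp only: sum_distrib_right)
    also have "\<dots> = (\<Sum>k'<p. if k' = k then of_nat p * Ds ! k' $$ (i, j) else 0)"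
      using k by (intro sum.cong) (auto simp: sum_dft_root_orthogonal simp del: complex_cnj_power)
    also have "\<dots> = of_nat p * Ds ! k $$ (i, j)" using k by (simp add: sum.delta)
    finally show "Ds ! k $$ (i, j) = tdft (?w ^ k) T $$ (i, j)" using p by simp
  qed (use dim[OF k] in auto)
  then show "Ds = map (\<lambda>k. tdft (?w ^ k) T) [0..<p]"
    using Ds by (intro nth_equalityI) auto
next
  assume Ds: "Ds = map (\<lambda>k. tdft (dft_root p ^ k) T) [0..<p]"
  show "fourier_blocks m n p T Ds"
    unfolding fourier_blocks_iff_inverse_dft[OF T]
    using tdft_carrier[OF p T] inverse_dft[OF p T] by (auto simp: Ds)
qed

text \<open>Discharges the description operator in \<open>tkron\<close>: the blocks of
  \<open>S\<close> and \<open>T\<close> are determined by evaluation, and a tensor is determined by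
  its own blocks, so any candidate with the right evaluations is the Kronecker product.\<close>

lemma tkron_eqI:
  assumes S: "S \<in> tensors m n p" and T: "T \<in> tensors t s p" and U: "U \<in> tensors (m * t) (n * s) p"
    and eq: "\<And>w. w ^ p = 1 \<Longrightarrow> tdft w U = mat_kron (tdft w S) (tdft w T)"
  shows "tkron S T = U"
proof -
  let ?F = "\<lambda>V. map (\<lambda>k. tdft (dft_root p ^ k) V) [0..<p]"
  have U': "map2 mat_kron (?F S) (?F T) = ?F U"
    by (intro nth_equalityI) (auto simp: eq dft_root_power_power_eq_1[OF p])
  have inj: "V = U" if V: "V \<in> tensors (m * t) (n * s) p" and FV: "?F V = ?F U" for V
  proof (rule tensor_eqI[OF V U])
    fix i j k assume *: "i < m * t" "j < n * s" "k < p"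
    have "tdft (dft_root p ^ l) V = tdft (dft_root p ^ l) U" if "l < p" for l
      using FV that by (simp add: map_eq_conv)
    then have "of_nat p * complex_of_real (V ! k $$ (i, j)) = of_nat p * complex_of_real (U ! k $$ (i, j))"
      using * by (simp add: inverse_dft[OF p V, symmetric] inverse_dft[OF p U, symmetric] del: complex_cnj_power)
    then show "V ! k $$ (i, j) = U ! k $$ (i, j)" using p by simp
  qed
  have *: "trow S = m" "tcol S = n" "trow T = t" "tcol T = s" "length S = p"
    using S T p by (auto simp: tensorsD)
  show ?thesis
    unfolding tkron_def Let_def *
  proof (rule the_equality)
    show "U \<in> tensors (m * t) (n * s) p \<and> (\<exists>As Bs. fourier_blocks m n p S As \<and> fourier_blocks t s p T Bs \<and>
        fourier_blocks (m * t) (n * s) p U (map2 mat_kron As Bs))"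
      using S T U U' by (simp add: fourier_blocks_iff_tdft)
  next
    fix V assume "V \<in> tensors (m * t) (n * s) p \<and> (\<exists>As Bs. fourier_blocks m n p S As \<and> fourier_blocks t s p T Bs \<and>
        fourier_blocks (m * t) (n * s) p V (map2 mat_kron As Bs))"
    then show "V = U" using S T U' by (intro inj) (auto simp: fourier_blocks_iff_tdft)
  qed
qed

end

subsection \<open>Tensor arithmetic\<close>

text \<open>Lets the laws for scalar multiples handle negation.\<close>

lemma tuminus_conv_tsmult: "tuminus T = (- 1) \<cdot>\<^sub>T T"
  by (auto simp: tuminus_def tsmult_def intro!: eq_matI)

context
  fixes p :: nat
  assumes p: "0 < p"
begin

lemma tprod_assoc:
  assumes S: "S \<in> tensors m n p" and T: "T \<in> tensors n s p" and U: "U \<in> tensors s t p"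
  shows "(S *\<^sub>T T) *\<^sub>T U = S *\<^sub>T (T *\<^sub>T U)"
proof (rule tensor_eqI_tdft[OF p])
  fix w :: complex assume w: "w ^ p = 1"
  note * = tdft_tprod[OF p _ _ w] tprod_closed
  show "tdft w ((S *\<^sub>T T) *\<^sub>T U) = tdft w (S *\<^sub>T (T *\<^sub>T U))"
    unfolding *(1)[OF *(2)[OF S T] U] *(1)[OF S T] *(1)[OF S *(2)[OF T U]] *(1)[OF T U]
    by (rule assoc_mult_mat) (rule tdft_carrier[OF p] S T U)+
qed (rule tprod_closed S T U)+

lemma tprod_tplus_distrib_left:
  assumes S: "S \<in> tensors m n p" and T: "T \<in> tensors n s p" and U: "U \<in> tensors n s p"
  shows "S *\<^sub>T (T +\<^sub>T U) = S *\<^sub>T T +\<^sub>T S *\<^sub>T U"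
proof (rule tensor_eqI_tdft[OF p])
  fix w :: complex assume w: "w ^ p = 1"
  show "tdft w (S *\<^sub>T (T +\<^sub>T U)) = tdft w (S *\<^sub>T T +\<^sub>T S *\<^sub>T U)"
    unfolding tdft_tprod[OF p S tplus_closed[OF T U] w] tdft_tplus[OF p T U]
      tdft_tplus[OF p tprod_closed[OF S T] tprod_closed[OF S U]]
      tdft_tprod[OF p S T w] tdft_tprod[OF p S U w]
    by (rule mult_add_distrib_mat) (rule tdft_carrier[OF p] S T U)+
qed (rule tensor_closed S T U)+

lemma tprod_tplus_distrib_right:
  assumes S: "S \<in> tensors m n p" and T: "T \<in> tensors m n p" and U: "U \<in> tensors n s p"
  shows "(S +\<^sub>T T) *\<^sub>T U = S *\<^sub>T U +\<^sub>T T *\<^sub>T U"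
proof (rule tensor_eqI_tdft[OF p])
  fix w :: complex assume w: "w ^ p = 1"
  show "tdft w ((S +\<^sub>T T) *\<^sub>T U) = tdft w (S *\<^sub>T U +\<^sub>T T *\<^sub>T U)"
    unfolding tdft_tprod[OF p tplus_closed[OF S T] U w] tdft_tplus[OF p S T]
      tdft_tplus[OF p tprod_closed[OF S U] tprod_closed[OF T U]]
      tdft_tprod[OF p S U w] tdft_tprod[OF p T U w]
    by (rule add_mult_distrib_mat) (rule tdft_carrier[OF p] S T U)+
qed (rule tensor_closed S T U)+

lemma tprod_tsmult_left:
  assumes S: "S \<in> tensors m n p" and T: "T \<in> tensors n s p"
  shows "(a \<cdot>\<^sub>T S) *\<^sub>T T = a \<cdot>\<^sub>T (S *\<^sub>T T)"
proof (rule tensor_eqI_tdft[OF p])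
  fix w :: complex assume w: "w ^ p = 1"
  show "tdft w ((a \<cdot>\<^sub>T S) *\<^sub>T T) = tdft w (a \<cdot>\<^sub>T (S *\<^sub>T T))"
    unfolding tdft_tprod[OF p tsmult_closed[OF S] T w] tdft_tsmult[OF p S]
      tdft_tsmult[OF p tprod_closed[OF S T]] tdft_tprod[OF p S T w]
    by (rule mult_smult_assoc_mat) (rule tdft_carrier[OF p] S T)+
qed (rule tensor_closed S T)+

lemma tprod_tsmult_right:
  assumes S: "S \<in> tensors m n p" and T: "T \<in> tensors n s p"
  shows "S *\<^sub>T (a \<cdot>\<^sub>T T) = a \<cdot>\<^sub>T (S *\<^sub>T T)"
proof (rule tensor_eqI_tdft[OF p])
  fix w :: complex assume w: "w ^ p = 1"
  show "tdft w (S *\<^sub>T (a \<cdot>\<^sub>T T)) = tdft w (a \<cdot>\<^sub>T (S *\<^sub>T T))"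
    unfolding tdft_tprod[OF p S tsmult_closed[OF T] w] tdft_tsmult[OF p T]
      tdft_tsmult[OF p tprod_closed[OF S T]] tdft_tprod[OF p S T w]
    by (rule mult_smult_distrib) (rule tdft_carrier[OF p] S T)+
qed (rule tensor_closed S T)+

lemma tprod_tid_right:
  assumes T: "T \<in> tensors m n p"
  shows "T *\<^sub>T tid n p = T"
proof (rule tensor_eqI_tdft[OF p])
  fix w :: complex assume w: "w ^ p = 1"
  show "tdft w (T *\<^sub>T tid n p) = tdft w T"
    unfolding tdft_tprod[OF p T tid_closed w] tdft_tid[OF p]
    by (rule right_mult_one_mat) (rule tdft_carrier[OF p T])
qed (rule tensor_closed T)+

lemma tprod_tid_left:
  assumes T: "T \<in> tensors m n p"
  shows "tid m p *\<^sub>T T = T"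
proof (rule tensor_eqI_tdft[OF p])
  fix w :: complex assume w: "w ^ p = 1"
  show "tdft w (tid m p *\<^sub>T T) = tdft w T"
    unfolding tdft_tprod[OF p tid_closed T w] tdft_tid[OF p]
    by (rule left_mult_one_mat) (rule tdft_carrier[OF p T])
qed (rule tensor_closed T)+

text \<open>Every evaluation of a tube is a matrix of size one.\<close>

lemma tube_tprod_commute:
  assumes S: "S \<in> tensors 1 1 p" and T: "T \<in> tensors 1 1 p"
  shows "S *\<^sub>T T = T *\<^sub>T S"
proof (rule tensor_eqI_tdft[OF p])
  fix w :: complex assume w: "w ^ p = 1"
  show "tdft w (S *\<^sub>T T) = tdft w (T *\<^sub>T S)"
    unfolding tdft_tprod[OF p S T w] tdft_tprod[OF p T S w]
    by (rule eq_matI) (auto simp: tdft_dim[OF p S] tdft_dim[OF p T] scalar_prod_def)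
qed (rule tensor_closed S T)+

lemma ttranspose_ttranspose:
  assumes T: "T \<in> tensors m n p"
  shows "T\<^sup>\<top>\<^sup>\<top> = T"
proof (rule tensor_eqI)
  fix i j k assume *: "i < m" "j < n" "k < p"
  then have "(p - (p - k) mod p) mod p = k" by (cases "k = 0") simp_all
  then show "T\<^sup>\<top>\<^sup>\<top> ! k $$ (i, j) = T ! k $$ (i, j)"
    using * p by (simp add: ttranspose_index[OF ttranspose_closed[OF T]] ttranspose_index[OF T])
qed (rule ttranspose_closed T)+

lemma ttranspose_tprod:
  assumes S: "S \<in> tensors m n p" and T: "T \<in> tensors n s p"
  shows "(S *\<^sub>T T)\<^sup>\<top> = T\<^sup>\<top> *\<^sub>T S\<^sup>\<top>"
proof (rule tensor_eqI_tdft[OF p])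
  fix w :: complex assume w: "w ^ p = 1"
  then have w': "inverse w ^ p = 1" by (simp add: power_inverse)
  show "tdft w ((S *\<^sub>T T)\<^sup>\<top>) = tdft w (T\<^sup>\<top> *\<^sub>T S\<^sup>\<top>)"
    unfolding tdft_ttranspose[OF p tprod_closed[OF S T] w] tdft_tprod[OF p S T w']
      tdft_tprod[OF p ttranspose_closed[OF T] ttranspose_closed[OF S] w]
      tdft_ttranspose[OF p S w] tdft_ttranspose[OF p T w]
    by (rule transpose_mult) (rule tdft_carrier[OF p] S T)+
qed (rule tensor_closed S T)+

lemma ttranspose_tplus:
  assumes S: "S \<in> tensors m n p" and T: "T \<in> tensors m n p"
  shows "(S +\<^sub>T T)\<^sup>\<top> = S\<^sup>\<top> +\<^sub>T T\<^sup>\<top>"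
  using assms p
  by (intro tensor_eqI[of _ n m p])
    (simp_all add: tensor_closed ttranspose_index[of _ m n p] tensor_index[of _ m n p] tensor_index[of _ n m p])

lemma ttranspose_tsmult:
  assumes S: "S \<in> tensors m n p"
  shows "(a \<cdot>\<^sub>T S)\<^sup>\<top> = a \<cdot>\<^sub>T S\<^sup>\<top>"
  using assms p
  by (intro tensor_eqI[of _ n m p])
    (simp_all add: tensor_closed ttranspose_index[of _ m n p] tensor_index[of _ m n p] tensor_index[of _ n m p])

text \<open>The identity tensor evaluates to the identity matrix, and the Kronecker product of a
  matrix of size one with it is a scalar matrix.\<close>

lemma tkron_tid:
  assumes S: "S \<in> tensors 1 1 p"
  shows "tkron S (tid n p) \<in> tensors n n p"
    and "w ^ p = 1 \<Longrightarrow> tdft w (tkron S (tid n p)) = (tdft w S $$ (0, 0)) \<cdot>\<^sub>m 1\<^sub>m n"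
proof -
  \<comment> \<open>The candidate spreads each entry of the tube along the diagonal of a slice; by
    linearity its evaluations are the required scalar matrices.\<close>
  define U where "U = map (\<lambda>k. (S ! k $$ (0, 0)) \<cdot>\<^sub>m 1\<^sub>m n) [0..<p]"
  have U: "U \<in> tensors n n p" by (rule tensorsI) (simp_all add: U_def)
  have U_index: "U ! k $$ (i, j) = (if i = j then S ! k $$ (0, 0) else 0)" if "k < p" "i < n" "j < n" for k i j
    using that by (simp add: U_def)
  have dft: "tdft w U = (tdft w S $$ (0, 0)) \<cdot>\<^sub>m 1\<^sub>m n" for w
    by (rule eq_matI) (auto simp: tdft_dim[OF p U] tdft_index[OF p U] tdft_index[OF p S] U_index)
  have "tkron S (tid n p) = U"
    by (rule tkron_eqI[OF p S tid_closed])
      (use U in \<open>auto simp: dft tdft_tid[OF p] tdft_dim[OF p S] mat_kron_index intro!: eq_matI\<close>)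
  then show "tkron S (tid n p) \<in> tensors n n p"
    and "w ^ p = 1 \<Longrightarrow> tdft w (tkron S (tid n p)) = (tdft w S $$ (0, 0)) \<cdot>\<^sub>m 1\<^sub>m n"
    using U dft by simp_all
qed

text \<open>At each \<open>w\<close> both sides scale the column \<open>tdft w T\<close> by the
  single entry of \<open>tdft w S\<close>.\<close>

lemma tkron_tid_tprod:
  assumes S: "S \<in> tensors 1 1 p" and T: "T \<in> tensors n 1 p"
  shows "tkron S (tid n p) *\<^sub>T T = T *\<^sub>T S"
proof (rule tensor_eqI_tdft[OF p])
  fix w :: complex assume w: "w ^ p = 1"
  have "(tdft w S $$ (0, 0) \<cdot>\<^sub>m 1\<^sub>m n) * tdft w T = tdft w S $$ (0, 0) \<cdot>\<^sub>m tdft w T"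
    using tdft_carrier[OF p T, of w] by (simp add: mult_smult_assoc_mat[of _ n n _ 1])
  also have "\<dots> = tdft w T * tdft w S"
    by (rule eq_matI) (auto simp: tdft_dim[OF p S] tdft_dim[OF p T] scalar_prod_def)
  finally show "tdft w (tkron S (tid n p) *\<^sub>T T) = tdft w (T *\<^sub>T S)"
    unfolding tdft_tprod[OF p tkron_tid(1)[OF S] T w] tdft_tprod[OF p T S w] tkron_tid(2)[OF S w] .
qed (rule tkron_tid(1)[OF S] tprod_closed S T)+

section \<open>Products of block tensors\<close>

lemma tvcat_tprod:
  assumes S: "S \<in> tensors m n p" and T: "T \<in> tensors t n p" and U: "U \<in> tensors n s p"
  shows "tvcat S T *\<^sub>T U = tvcat (S *\<^sub>T U) (T *\<^sub>T U)"
proof (rule tensor_eqI)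
  fix i j k assume *: "i < m + t" "j < s" "k < p"
  show "(tvcat S T *\<^sub>T U) ! k $$ (i, j) = tvcat (S *\<^sub>T U) (T *\<^sub>T U) ! k $$ (i, j)"
    using * p
    by (simp add: tprod_index[OF tvcat_closed[OF S T] U] tvcat_index[OF S T] tprod_index[OF S U]
        tprod_index[OF T U] tvcat_index[OF tprod_closed[OF S U] tprod_closed[OF T U]])
qed (rule tensor_closed S T U)+

lemma thcat_tprod_tvcat:
  assumes P: "P \<in> tensors m n p" and Q: "Q \<in> tensors m s p"
    and U: "U \<in> tensors n t p" and V: "V \<in> tensors s t p"
  shows "thcat P Q *\<^sub>T tvcat U V = P *\<^sub>T U +\<^sub>T Q *\<^sub>T V"
proof (rule tensor_eqI)
  fix i j k assume *: "i < m" "j < t" "k < p"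
  show "(thcat P Q *\<^sub>T tvcat U V) ! k $$ (i, j) = (P *\<^sub>T U +\<^sub>T Q *\<^sub>T V) ! k $$ (i, j)"
    using * p tprod_closed[OF P U] tprod_closed[OF Q V]
    by (simp add: tprod_index[OF thcat_closed[OF P Q] tvcat_closed[OF U V]] sum_lessThan_add sum.distrib
        thcat_index[OF P Q] tvcat_index[OF U V] tensor_index[of _ m t p] tprod_index[OF P U] tprod_index[OF Q V])
qed (rule tensor_closed P Q U V)+

end

subsection \<open>Inner products and stationarity\<close>

definition tinner :: "tensor \<Rightarrow> tensor \<Rightarrow> real" where
  "tinner S T = (\<Sum>k<length S. \<Sum>i<trow S. \<Sum>j<tcol S. S ! k $$ (i, j) * T ! k $$ (i, j))"

text \<open>The coordinate directions, along which the partial derivatives are directional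
  derivatives.\<close>

definition tunit :: "nat \<Rightarrow> nat \<Rightarrow> nat \<Rightarrow> nat \<Rightarrow> nat \<Rightarrow> nat \<Rightarrow> tensor" where
  "tunit m n p i j k = map (\<lambda>l. mat m n (\<lambda>(a, b). if l = k \<and> a = i \<and> b = j then 1 else 0)) [0..<p]"

lemma tunit_closed: "tunit m n p i j k \<in> tensors m n p"
  by (rule tensorsI) (simp_all add: tunit_def)

context
  fixes p :: nat
  assumes p: "0 < p"
begin

lemma tinner_index:
  "S \<in> tensors m n p \<Longrightarrow> tinner S T = (\<Sum>k<p. \<Sum>i<m. \<Sum>j<n. S ! k $$ (i, j) * T ! k $$ (i, j))"
  using p by (simp add: tinner_def tensorsD)

lemma tnorm_square: "(tnorm S)\<^sup>2 = tinner S S"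
  unfolding tnorm_def tinner_def power2_eq_square[symmetric]
  by (rule real_sqrt_pow2) (intro sum_nonneg zero_le_power2)

lemma tinner_tuminus:
  assumes "S \<in> tensors m n p" "T \<in> tensors m n p"
  shows "tinner S (tuminus T) = - tinner S T"
  using assms by (simp add: tinner_index[of _ m n] tensor_index[of _ m n p] sum_negf)

lemma tinner_ttranspose:
  assumes S: "S \<in> tensors m n p" and T: "T \<in> tensors m n p"
  shows "tinner (S\<^sup>\<top>) (T\<^sup>\<top>) = tinner S T"
proof -
  let ?f = "\<lambda>k. \<Sum>i<n. \<Sum>j<m. S ! k $$ (j, i) * T ! k $$ (j, i)"
  have "tinner (S\<^sup>\<top>) (T\<^sup>\<top>) = (\<Sum>k<p. ?f ((p - k) mod p))"
    by (simp add: tinner_index[OF ttranspose_closed[OF S]] ttranspose_index[OF S] ttranspose_index[OF T])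
  also have "\<dots> = (\<Sum>k<p. ?f k)"
  proof (rule sum.reindex_bij_witness[of _ "\<lambda>k. (p - k) mod p" "\<lambda>k. (p - k) mod p"])
    fix k assume "k \<in> {..<p}"
    then show "(p - (p - k) mod p) mod p = k" "(p - (p - k) mod p) mod p = k"
      by (cases "k = 0", simp_all)+
  qed (use p in auto)
  also have "\<dots> = tinner S T"
    by (simp add: tinner_index[OF S] sum.swap[of _ "{..<m}" "{..<n}"])
  finally show ?thesis .
qed

text \<open>The tensor transpose is the adjoint for the Frobenius inner product: both sides are the
  same fivefold sum in different order.\<close>

lemma tinner_tprod_right:
  assumes R: "R \<in> tensors m s p" and S: "S \<in> tensors m n p" and T: "T \<in> tensors n s p"
  shows "tinner R (S *\<^sub>T T) = tinner (S\<^sup>\<top> *\<^sub>T R) T"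
proof -
  let ?h = "\<lambda>k i j l a. R ! k $$ (i, j) * S ! ((p + k - l) mod p) $$ (i, a) * T ! l $$ (a, j)"
  \<comment> \<open>The convolution index on the right, reflected by the transpose, is the
    convolution index on the left.\<close>
  have idx: "(p - (p + l - k) mod p) mod p = (p + k - l) mod p" if "k < p" "l < p" for k l
    using that by (cases "k \<le> l"; cases "k = l") (auto simp: mod_if)
  have "tinner R (S *\<^sub>T T) = (\<Sum>k<p. \<Sum>i<m. \<Sum>j<s. \<Sum>l<p. \<Sum>a<n. ?h k i j l a)"
    by (simp add: tinner_index[OF R] tprod_index[OF S T] sum_distrib_left mult_ac)
  \<comment> \<open>As one sum over tuples, the order is changed by a single reindexing.\<close>
  also have "\<dots> = (\<Sum>(k, i, j, l, a)\<in>{..<p} \<times> {..<m} \<times> {..<s} \<times> {..<p} \<times> {..<n}. ?h k i j l a)"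
    by (simp add: sum.cartesian_product)
  also have "\<dots> = (\<Sum>(l, a, j, k, i)\<in>{..<p} \<times> {..<n} \<times> {..<s} \<times> {..<p} \<times> {..<m}. ?h k i j l a)"
    by (rule sum.reindex_bij_witness[of _ "\<lambda>(l, a, j, k, i). (k, i, j, l, a)" "\<lambda>(k, i, j, l, a). (l, a, j, k, i)"]) auto
  also have "\<dots> = (\<Sum>l<p. \<Sum>a<n. \<Sum>j<s. \<Sum>k<p. \<Sum>i<m. ?h k i j l a)"
    by (simp add: sum.cartesian_product)
  also have "\<dots> = tinner (S\<^sup>\<top> *\<^sub>T R) T"
    using p by (simp add: tinner_index[OF tprod_closed[OF ttranspose_closed[OF S] R]]
        tprod_index[OF ttranspose_closed[OF S] R] ttranspose_index[OF S] idx sum_distrib_left mult_ac)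
  finally show ?thesis .
qed

text \<open>Transposing both arguments keeps the inner product and reverses the product, which
  reduces the claim to \<open>tinner_tprod_right\<close>.\<close>

lemma tinner_tprod_left:
  assumes R: "R \<in> tensors m s p" and S: "S \<in> tensors m n p" and T: "T \<in> tensors n s p"
  shows "tinner R (S *\<^sub>T T) = tinner (R *\<^sub>T T\<^sup>\<top>) S"
proof -
  note tr = ttranspose_closed
  have "tinner R (S *\<^sub>T T) = tinner (R\<^sup>\<top>) (T\<^sup>\<top> *\<^sub>T S\<^sup>\<top>)"
    using tinner_ttranspose[OF R tprod_closed[OF S T]] ttranspose_tprod[OF p S T] by simp
  also have "\<dots> = tinner (T\<^sup>\<top>\<^sup>\<top> *\<^sub>T R\<^sup>\<top>) (S\<^sup>\<top>)"
    by (rule tinner_tprod_right[OF tr[OF R] tr[OF T] tr[OF S]])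
  also have "\<dots> = tinner (R *\<^sub>T T\<^sup>\<top>) S"
    unfolding ttranspose_tprod[OF p R tr[OF T], symmetric]
    by (rule tinner_ttranspose[OF tprod_closed[OF R tr[OF T]] S])
  finally show ?thesis .
qed

lemma tnorm_square_thcat:
  assumes S: "S \<in> tensors m n p" and T: "T \<in> tensors m s p"
  shows "(tnorm (thcat S T))\<^sup>2 = (tnorm S)\<^sup>2 + (tnorm T)\<^sup>2"
proof -
  show ?thesis
    by (simp add: tnorm_square tinner_index[OF S] tinner_index[OF T] tinner_index[OF thcat_closed[OF S T]]
        thcat_index[OF S T] sum_lessThan_add sum.distrib)
qed

lemma thcat_tminus_thcat:
  assumes S: "S \<in> tensors m n p" "S' \<in> tensors m n p" and T: "T \<in> tensors m s p" "T' \<in> tensors m s p"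
  shows "thcat S T -\<^sub>T thcat S' T' = thcat (S -\<^sub>T S') (T -\<^sub>T T')"
  using assms
  by (intro tensor_eqI[of _ m "n + s" p])
    (simp_all add: tensor_closed tensor_index[of _ m "n + s" p] thcat_index[of _ m n p _ s]
      tensor_index[of _ m n p] tensor_index[of _ m s p])

text \<open>The squared norm is a quadratic polynomial in \<open>x - x0\<close>; at
  \<open>x0\<close> only its linear coefficient contributes.\<close>

lemma has_real_derivative_tnorm_square:
  assumes S: "S \<in> tensors m n p" and T: "T \<in> tensors m n p"
  shows "((\<lambda>x. (tnorm (S +\<^sub>T (x - x0) \<cdot>\<^sub>T T))\<^sup>2) has_real_derivative 2 * tinner S T) (at x0)"
proof -
  have eq: "(tnorm (S +\<^sub>T (x - x0) \<cdot>\<^sub>T T))\<^sup>2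
      = (\<Sum>k<p. \<Sum>i<m. \<Sum>j<n. (S ! k $$ (i, j) + (x - x0) * T ! k $$ (i, j))\<^sup>2)" for x
    unfolding tnorm_square tinner_index[OF tplus_closed[OF S tsmult_closed[OF T]]]
    using S T by (simp add: tensor_closed tensor_index[of _ m n p] power2_eq_square)
  show ?thesis
    unfolding eq tinner_index[OF S] sum_distrib_left
    by (auto intro!: derivative_eq_intros sum.cong)
qed

lemma tinner_tunit:
  assumes S: "S \<in> tensors m n p" and ijk: "i < m" "j < n" "k < p"
  shows "tinner S (tunit m n p i j k) = S ! k $$ (i, j)"
proof -
  have "tinner S (tunit m n p i j k)
      = (\<Sum>l<p. \<Sum>a<m. \<Sum>b<n. if b = j then if a = i then if l = k then S ! l $$ (a, b) else 0 else 0 else 0)"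
    unfolding tinner_index[OF S] by (intro sum.cong) (auto simp: tunit_def)
  then show ?thesis using ijk by (simp add: sum.delta)
qed

lemma tupdate_conv_tunit:
  assumes T: "T \<in> tensors m n p" and ijk: "i < m" "j < n" "k < p"
  shows "tupdate T i j k x = T +\<^sub>T (x - T ! k $$ (i, j)) \<cdot>\<^sub>T tunit m n p i j k"
proof (rule tensor_eqI)
  show "tupdate T i j k x \<in> tensors m n p"
    using T ijk by (intro tensorsI) (auto simp: tupdate_def tensorsD nth_list_update)
  fix a b l assume *: "a < m" "b < n" "l < p"
  then show "tupdate T i j k x ! l $$ (a, b) = (T +\<^sub>T (x - T ! k $$ (i, j)) \<cdot>\<^sub>T tunit m n p i j k) ! l $$ (a, b)"
    using T ijk tunit_closed[of m n p i j k]
    by (auto simp: tupdate_def tensor_index[of _ m n p] tensor_closed tunit_def tensorsD nth_list_update)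
qed (rule tensor_closed T tunit_closed)+

end

section \<open>The Lagrangian and its stationarity conditions\<close>

lemma tminus_perturb:
  assumes "S \<in> tensors m n p" "T \<in> tensors m n p" "U \<in> tensors m n p"
  shows "S -\<^sub>T (T +\<^sub>T a \<cdot>\<^sub>T U) = (S -\<^sub>T T) +\<^sub>T a \<cdot>\<^sub>T tuminus U"
  using assms
  by (intro tensor_eqI[of _ m n p]) (simp_all add: tensor_closed tensor_index[of _ m n p])

lemma tminus_tplus_cancel:
  assumes "S \<in> tensors m n p" "T \<in> tensors m n p"
  shows "(S -\<^sub>T T) +\<^sub>T T = S"
  using assms
  by (intro tensor_eqI[of _ m n p]) (simp_all add: tensor_closed tensor_index[of _ m n p])

lemma tr_tls_lagrangian_split:
  assumes p: "0 < p" and "A \<in> tensors m n p" "B \<in> tensors m 1 p" "Z \<in> tensors m n p" "Y \<in> tensors n 1 p"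
  shows "tr_tls_lagrangian A B K \<delta> Z Y \<mu>
    = (tnorm (A -\<^sub>T Z))\<^sup>2 + (tnorm (B -\<^sub>T Z *\<^sub>T Y))\<^sup>2 + \<mu> * ((tnorm (K *\<^sub>T Y))\<^sup>2 - \<delta>\<^sup>2)"
proof -
  have ZY: "Z *\<^sub>T Y \<in> tensors m 1 p" by (rule tprod_closed) fact+
  show ?thesis
    unfolding tr_tls_lagrangian_def thcat_tminus_thcat[OF p assms(2,4,3) ZY]
      tnorm_square_thcat[OF p tminus_closed[OF assms(2,4)] tminus_closed[OF assms(3) ZY]] ..
qed

text \<open>Changing one entry of \<open>At\<close> by \<open>h\<close> moves
  \<open>A -\<^sub>T At\<close> by \<open>- h\<close> times the unit tensor \<open>E\<close> and the
  residual by \<open>- h\<close> times \<open>E *\<^sub>T X\<close>, while the constraint term is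
  constant. The vanishing derivative thus says entrywise that \<open>A -\<^sub>T At\<close> and
  \<open>R *\<^sub>T X\<^sup>\<top>\<close> add up to zero, where \<open>R\<close> is the
  residual.\<close>

lemma tr_tls_stationary_matrix:
  assumes p: "0 < p" and A: "A \<in> tensors m n p" and B: "B \<in> tensors m 1 p"
    and At: "At \<in> tensors m n p" and X: "X \<in> tensors n 1 p"
    and stat: "tderiv_vanishes m n p (\<lambda>Z. tr_tls_lagrangian A B K \<delta> Z X \<mu>) At"
  shows "At = A +\<^sub>T (B -\<^sub>T At *\<^sub>T X) *\<^sub>T X\<^sup>\<top>"
proof -
  let ?R = "B -\<^sub>T At *\<^sub>T X"
  have AtX: "At *\<^sub>T X \<in> tensors m 1 p" by (rule tensor_closed At X)+
  have R: "?R \<in> tensors m 1 p" by (rule tensor_closed B AtX)+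
  have RX: "?R *\<^sub>T X\<^sup>\<top> \<in> tensors m n p" by (rule tensor_closed R X)+
  have D: "A -\<^sub>T At \<in> tensors m n p" by (rule tensor_closed A At)+
  show ?thesis
  proof (rule tensor_eqI[OF At])
    fix i j k assume ijk: "i < m" "j < n" "k < p"
    let ?E = "tunit m n p i j k" and ?x = "At ! k $$ (i, j)"
    have E: "?E \<in> tensors m n p" by (rule tunit_closed)
    have EX: "?E *\<^sub>T X \<in> tensors m 1 p" by (rule tensor_closed E X)+
    have L: "tr_tls_lagrangian A B K \<delta> (tupdate At i j k x) X \<mu>
        = (tnorm ((A -\<^sub>T At) +\<^sub>T (x - ?x) \<cdot>\<^sub>T tuminus ?E))\<^sup>2
          + (tnorm (?R +\<^sub>T (x - ?x) \<cdot>\<^sub>T tuminus (?E *\<^sub>T X)))\<^sup>2 + \<mu> * ((tnorm (K *\<^sub>T X))\<^sup>2 - \<delta>\<^sup>2)" for x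
      unfolding tupdate_conv_tunit[OF p At ijk]
        tr_tls_lagrangian_split[OF p A B tplus_closed[OF At tsmult_closed[OF E]] X]
        tprod_tplus_distrib_right[OF p At tsmult_closed[OF E] X] tprod_tsmult_left[OF p E X]
        tminus_perturb[OF A At E] tminus_perturb[OF B AtX EX] ..
    have deriv: "((\<lambda>x. (tnorm ((A -\<^sub>T At) +\<^sub>T (x - ?x) \<cdot>\<^sub>T tuminus ?E))\<^sup>2
          + (tnorm (?R +\<^sub>T (x - ?x) \<cdot>\<^sub>T tuminus (?E *\<^sub>T X)))\<^sup>2 + \<mu> * ((tnorm (K *\<^sub>T X))\<^sup>2 - \<delta>\<^sup>2))
        has_real_derivative 2 * tinner (A -\<^sub>T At) (tuminus ?E) + 2 * tinner ?R (tuminus (?E *\<^sub>T X)) + 0) (at ?x)"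
      by (intro DERIV_add DERIV_const has_real_derivative_tnorm_square[OF p D tuminus_closed[OF E]]
          has_real_derivative_tnorm_square[OF p R tuminus_closed[OF EX]])
    have "((\<lambda>x. tr_tls_lagrangian A B K \<delta> (tupdate At i j k x) X \<mu>) has_real_derivative 0) (at ?x)"
      using stat ijk unfolding tderiv_vanishes_def by blast
    from DERIV_unique[OF deriv this[unfolded L]]
    have "2 * tinner (A -\<^sub>T At) (tuminus ?E) + 2 * tinner ?R (tuminus (?E *\<^sub>T X)) + 0 = 0" .
    then have "tinner (A -\<^sub>T At) ?E + tinner ?R (?E *\<^sub>T X) = 0"
      by (simp add: tinner_tuminus[OF p D E] tinner_tuminus[OF p R EX])
    \<comment> \<open>Once \<open>X\<close> is moved to the other argument, both inner products are
      taken with the unit tensor and read off one entry.\<close>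
    then have "(A -\<^sub>T At) ! k $$ (i, j) + (?R *\<^sub>T X\<^sup>\<top>) ! k $$ (i, j) = 0"
      by (simp add: tinner_tprod_left[OF p R E X] tinner_tunit[OF p D ijk] tinner_tunit[OF p RX ijk])
    then show "At ! k $$ (i, j) = (A +\<^sub>T ?R *\<^sub>T X\<^sup>\<top>) ! k $$ (i, j)"
      using ijk A At RX by (simp add: tensor_index[of _ m n p])
  qed (rule tensor_closed A RX)+
qed

text \<open>Here the first square is constant, while the residual moves by \<open>- h\<close> times
  \<open>At *\<^sub>T E\<close> and \<open>K *\<^sub>T X\<close> by \<open>h\<close> times
  \<open>K *\<^sub>T E\<close>. Moving \<open>At\<close> and \<open>K\<close> across the inner
  products turns the vanishing derivative into an identity of entries.\<close>

lemma tr_tls_stationary_solution: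
  assumes p: "0 < p" and A: "A \<in> tensors m n p" and B: "B \<in> tensors m 1 p" and K: "K \<in> tensors q n p"
    and At: "At \<in> tensors m n p" and X: "X \<in> tensors n 1 p"
    and stat: "tderiv_vanishes n 1 p (\<lambda>Z. tr_tls_lagrangian A B K \<delta> At Z \<mu>) X"
  shows "At\<^sup>\<top> *\<^sub>T (B -\<^sub>T At *\<^sub>T X) = \<mu> \<cdot>\<^sub>T (K\<^sup>\<top> *\<^sub>T (K *\<^sub>T X))"
proof -
  let ?R = "B -\<^sub>T At *\<^sub>T X"
  have AtX: "At *\<^sub>T X \<in> tensors m 1 p" by (rule tensor_closed At X)+
  have R: "?R \<in> tensors m 1 p" by (rule tensor_closed B AtX)+
  have AR: "At\<^sup>\<top> *\<^sub>T ?R \<in> tensors n 1 p" by (rule tensor_closed At R)+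
  have KX: "K *\<^sub>T X \<in> tensors q 1 p" by (rule tensor_closed K X)+
  have KKX: "K\<^sup>\<top> *\<^sub>T (K *\<^sub>T X) \<in> tensors n 1 p" by (rule tensor_closed K KX)+
  show ?thesis
  proof (rule tensor_eqI[OF AR])
    fix i j k :: nat assume ijk: "i < n" "j < 1" "k < p"
    let ?E = "tunit n 1 p i j k" and ?x = "X ! k $$ (i, j)"
    have E: "?E \<in> tensors n 1 p" by (rule tunit_closed)
    have AE: "At *\<^sub>T ?E \<in> tensors m 1 p" by (rule tensor_closed E At)+
    have KE: "K *\<^sub>T ?E \<in> tensors q 1 p" by (rule tensor_closed E K)+
    have L: "tr_tls_lagrangian A B K \<delta> At (tupdate X i j k x) \<mu>
        = (tnorm (A -\<^sub>T At))\<^sup>2 + (tnorm (?R +\<^sub>T (x - ?x) \<cdot>\<^sub>T tuminus (At *\<^sub>T ?E)))\<^sup>2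
          + \<mu> * ((tnorm (K *\<^sub>T X +\<^sub>T (x - ?x) \<cdot>\<^sub>T (K *\<^sub>T ?E)))\<^sup>2 - \<delta>\<^sup>2)" for x
      unfolding tupdate_conv_tunit[OF p X ijk]
        tr_tls_lagrangian_split[OF p A B At tplus_closed[OF X tsmult_closed[OF E]]]
        tprod_tplus_distrib_left[OF p At X tsmult_closed[OF E]] tprod_tsmult_right[OF p At E]
        tprod_tplus_distrib_left[OF p K X tsmult_closed[OF E]] tprod_tsmult_right[OF p K E]
        tminus_perturb[OF B AtX AE] ..
    have deriv: "((\<lambda>x. (tnorm (A -\<^sub>T At))\<^sup>2 + (tnorm (?R +\<^sub>T (x - ?x) \<cdot>\<^sub>T tuminus (At *\<^sub>T ?E)))\<^sup>2
          + \<mu> * ((tnorm (K *\<^sub>T X +\<^sub>T (x - ?x) \<cdot>\<^sub>T (K *\<^sub>T ?E)))\<^sup>2 - \<delta>\<^sup>2))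
        has_real_derivative 0 + 2 * tinner ?R (tuminus (At *\<^sub>T ?E)) + \<mu> * (2 * tinner (K *\<^sub>T X) (K *\<^sub>T ?E) - 0)) (at ?x)"
      by (intro DERIV_add DERIV_diff DERIV_cmult DERIV_const has_real_derivative_tnorm_square[OF p R tuminus_closed[OF AE]]
          has_real_derivative_tnorm_square[OF p KX KE])
    have "((\<lambda>x. tr_tls_lagrangian A B K \<delta> At (tupdate X i j k x) \<mu>) has_real_derivative 0) (at ?x)"
      using stat ijk unfolding tderiv_vanishes_def by blast
    from DERIV_unique[OF deriv this[unfolded L]]
    have "0 + 2 * tinner ?R (tuminus (At *\<^sub>T ?E)) + \<mu> * (2 * tinner (K *\<^sub>T X) (K *\<^sub>T ?E) - 0) = 0" .
    then have "tinner ?R (At *\<^sub>T ?E) = \<mu> * tinner (K *\<^sub>T X) (K *\<^sub>T ?E)"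
      unfolding tinner_tuminus[OF p R AE] by simp
    then show "(At\<^sup>\<top> *\<^sub>T ?R) ! k $$ (i, j) = (\<mu> \<cdot>\<^sub>T (K\<^sup>\<top> *\<^sub>T (K *\<^sub>T X))) ! k $$ (i, j)"
      using ijk
      by (simp only: tinner_tprod_right[OF p R At E] tinner_tprod_right[OF p KX K E]
          tinner_tunit[OF p AR ijk] tinner_tunit[OF p KKX ijk] tensor_index(4)[OF KKX ijk(3,1,2)])
  qed (rule tensor_closed KKX)+
qed

lemma tsmult_tvcat:
  assumes "S \<in> tensors m n p" "T \<in> tensors t n p"
  shows "a \<cdot>\<^sub>T tvcat S T = tvcat (a \<cdot>\<^sub>T S) (a \<cdot>\<^sub>T T)"
  using assms
  by (intro tensor_eqI[of _ "m + t" n p])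
    (simp_all add: tensor_closed tensor_index[of _ "m + t" n p] tvcat_index[of _ m n p _ t]
      tensor_index[of _ m n p] tensor_index[of _ t n p])

theorem theorem3p5:
  fixes m n p q :: nat and \<delta> \<mu> :: real
    and A B K At Bt X R lamI lamK Psi :: tensor
  assumes "m > 0" "n > 0" "p > 0" "q > 0"
    and "A \<in> tensors m n p" and "B \<in> tensors m 1 p" and "K \<in> tensors q n p"
    and solution: "tr_tls_solution m n p A B K \<delta> At Bt X"
    and active: "tnorm (K *\<^sub>T X) = \<delta>"
    and multiplier: "lagrange_multiplier m n p A B K \<delta> At X \<mu>"
    and R: "R = B -\<^sub>T At *\<^sub>T X"
    and lamI: "lamI = \<mu> \<cdot>\<^sub>T (X\<^sup>\<top> *\<^sub>T K\<^sup>\<top> *\<^sub>T K *\<^sub>T X) -\<^sub>T R\<^sup>\<top> *\<^sub>T R *\<^sub>T X\<^sup>\<top> *\<^sub>T X -\<^sub>T R\<^sup>\<top> *\<^sub>T B"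
    and lamK: "lamK = \<mu> \<cdot>\<^sub>T (tid 1 p +\<^sub>T X\<^sup>\<top> *\<^sub>T X)"
    and Psi: "Psi = tblock
      (A\<^sup>\<top> *\<^sub>T A +\<^sub>T K\<^sup>\<top> *\<^sub>T K *\<^sub>T tkron lamK (tid n p))  (A\<^sup>\<top> *\<^sub>T B)
      (B\<^sup>\<top> *\<^sub>T A)  (tuminus lamK *\<^sub>T X\<^sup>\<top> *\<^sub>T K\<^sup>\<top> *\<^sub>T K *\<^sub>T X +\<^sub>T B\<^sup>\<top> *\<^sub>T B)"
  shows "Psi *\<^sub>T tvcat X (tuminus (tid 1 p)) = tuminus (tvcat X (tuminus (tid 1 p))) *\<^sub>T lamI"
proof -
  note p = \<open>p > 0\<close> and A = \<open>A \<in> tensors m n p\<close> and B = \<open>B \<in> tensors m 1 p\<close> and K = \<open>K \<in> tensors q n p\<close>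
  note assoc = tprod_assoc[OF p] and dl = tprod_tplus_distrib_left[OF p]
    and dr = tprod_tplus_distrib_right[OF p] and sl = tprod_tsmult_left[OF p]
    and sr = tprod_tsmult_right[OF p] and tr = ttranspose_closed and tt = ttranspose_ttranspose[OF p]
    and trp = ttranspose_tprod[OF p] and pc = tprod_closed
  have At: "At \<in> tensors m n p" and X: "X \<in> tensors n 1 p"
    using solution by (auto simp: tr_tls_solution_def tr_tls_feasible_def)
  define G where "G = K\<^sup>\<top> *\<^sub>T (K *\<^sub>T X)"
  define H where "H = R\<^sup>\<top> *\<^sub>T R"
  define S where "S = tid 1 p +\<^sub>T X\<^sup>\<top> *\<^sub>T X"
  note I = tid_closed[of 1 p]
  have AtX: "At *\<^sub>T X \<in> tensors m 1 p" and AX: "A *\<^sub>T X \<in> tensors m 1 p" and KX: "K *\<^sub>T X \<in> tensors q 1 p"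
    and XX: "X\<^sup>\<top> *\<^sub>T X \<in> tensors 1 1 p" and KK: "K\<^sup>\<top> *\<^sub>T K \<in> tensors n n p"
    by (rule tensor_closed A At K X)+
  have Rc: "R \<in> tensors m 1 p" unfolding R by (rule tensor_closed B AtX)+
  have Gc: "G \<in> tensors n 1 p" unfolding G_def by (rule tensor_closed K KX)+
  have Hc: "H \<in> tensors 1 1 p" unfolding H_def by (rule tensor_closed Rc)+
  have Sc: "S \<in> tensors 1 1 p" unfolding S_def by (rule tensor_closed XX)+
  have XG: "X\<^sup>\<top> *\<^sub>T G \<in> tensors 1 1 p" and HS: "H *\<^sub>T S \<in> tensors 1 1 p" and RS: "R *\<^sub>T S \<in> tensors m 1 p"
    and RX: "R *\<^sub>T X\<^sup>\<top> \<in> tensors m n p" and AR: "A\<^sup>\<top> *\<^sub>T R \<in> tensors n 1 p" and XH: "X *\<^sub>T H \<in> tensors n 1 p"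
    and HXX: "H *\<^sub>T (X\<^sup>\<top> *\<^sub>T X) \<in> tensors 1 1 p" and BA: "B\<^sup>\<top> *\<^sub>T A \<in> tensors 1 n p"
    by (rule tensor_closed A B Rc X XX Gc Hc Sc)+
  have lamK_S: "lamK = \<mu> \<cdot>\<^sub>T S" unfolding lamK S_def ..
  have lamKc: "lamK \<in> tensors 1 1 p" unfolding lamK_S by (rule tensor_closed Sc)+
  have At_eq: "At = A +\<^sub>T R *\<^sub>T X\<^sup>\<top>"
    using tr_tls_stationary_matrix[OF p A B At X] multiplier unfolding R lagrange_multiplier_def by blast
  have AtR: "At\<^sup>\<top> *\<^sub>T R = \<mu> \<cdot>\<^sub>T G"
    using tr_tls_stationary_solution[OF p A B K At X] multiplier
    unfolding R G_def lagrange_multiplier_def by blast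

  \<comment> \<open>The first stationarity condition, transposed, eliminates \<open>At\<close> from
    the second.\<close>
  have F1: "\<mu> \<cdot>\<^sub>T G = A\<^sup>\<top> *\<^sub>T R +\<^sub>T X *\<^sub>T H"
  proof -
    have "\<mu> \<cdot>\<^sub>T G = (A\<^sup>\<top> +\<^sub>T X *\<^sub>T R\<^sup>\<top>) *\<^sub>T R"
      unfolding AtR[symmetric] At_eq ttranspose_tplus[OF p A RX] trp[OF Rc tr[OF X]] tt[OF X] ..
    also have "\<dots> = A\<^sup>\<top> *\<^sub>T R +\<^sub>T X *\<^sub>T H"
      unfolding dr[OF tr[OF A] pc[OF X tr[OF Rc]] Rc] assoc[OF X tr[OF Rc] Rc] H_def ..
    finally show ?thesis .
  qed
  have B_AtX: "B = R +\<^sub>T At *\<^sub>T X"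
    unfolding R by (rule tminus_tplus_cancel[OF B AtX, symmetric])
  have F2: "B = A *\<^sub>T X +\<^sub>T R *\<^sub>T S"
  proof -
    have "At *\<^sub>T X = A *\<^sub>T X +\<^sub>T R *\<^sub>T (X\<^sup>\<top> *\<^sub>T X)"
      by (subst At_eq) (simp only: dr[OF A RX X] assoc[OF Rc tr[OF X] X])
    then have "B = R +\<^sub>T (A *\<^sub>T X +\<^sub>T R *\<^sub>T (X\<^sup>\<top> *\<^sub>T X))" using B_AtX by simp
    also have "\<dots> = A *\<^sub>T X +\<^sub>T (R +\<^sub>T R *\<^sub>T (X\<^sup>\<top> *\<^sub>T X))"
      using Rc AX pc[OF Rc XX]
      by (intro tensor_eqI[of _ m 1 p]) (simp_all add: tensor_closed tensor_index[of _ m 1 p])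
    also have "R +\<^sub>T R *\<^sub>T (X\<^sup>\<top> *\<^sub>T X) = R *\<^sub>T S"
      unfolding S_def dl[OF Rc I XX] tprod_tid_right[OF p Rc] ..
    finally show ?thesis .
  qed
  \<comment> \<open>Here \<open>At\<close> is kept in the decomposition of \<open>B\<close>, so that
    the second stationarity condition applies directly.\<close>
  have F3: "B\<^sup>\<top> *\<^sub>T R = H +\<^sub>T \<mu> \<cdot>\<^sub>T (X\<^sup>\<top> *\<^sub>T G)"
  proof -
    have "B\<^sup>\<top> = R\<^sup>\<top> +\<^sub>T X\<^sup>\<top> *\<^sub>T At\<^sup>\<top>"
      by (subst B_AtX) (simp only: ttranspose_tplus[OF p Rc AtX] trp[OF At X])
    then show ?thesis
      by (simp only: dr[OF tr[OF Rc] pc[OF tr[OF X] tr[OF At]] Rc] assoc[OF tr[OF X] tr[OF At] Rc]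
          AtR sr[OF tr[OF X] Gc] H_def)
  qed
  have RB: "R\<^sup>\<top> *\<^sub>T B = H +\<^sub>T \<mu> \<cdot>\<^sub>T (X\<^sup>\<top> *\<^sub>T G)"
  proof -
    \<comment> \<open>Both summands of \<open>F3\<close> are built from Gram tubes: \<open>H\<close>
      is that of \<open>R\<close>, and \<open>X\<^sup>\<top> *\<^sub>T G\<close> that of
      \<open>K *\<^sub>T X\<close>.\<close>
    have gram: "(Y\<^sup>\<top> *\<^sub>T Y)\<^sup>\<top> = Y\<^sup>\<top> *\<^sub>T Y" if "Y \<in> tensors s 1 p" for Y s
      by (simp only: trp[OF tr[OF that] that] tt[OF that])
    have "X\<^sup>\<top> *\<^sub>T G = (K *\<^sub>T X)\<^sup>\<top> *\<^sub>T (K *\<^sub>T X)"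
      by (simp only: G_def trp[OF K X] assoc[OF tr[OF X] tr[OF K] KX])
    then have XG_sym: "(X\<^sup>\<top> *\<^sub>T G)\<^sup>\<top> = X\<^sup>\<top> *\<^sub>T G" using gram[OF KX] by simp
    have "R\<^sup>\<top> *\<^sub>T B = (B\<^sup>\<top> *\<^sub>T R)\<^sup>\<top>" by (simp only: trp[OF tr[OF B] Rc] tt[OF B])
    also have "\<dots> = H +\<^sub>T \<mu> \<cdot>\<^sub>T (X\<^sup>\<top> *\<^sub>T G)"
      unfolding F3 ttranspose_tplus[OF p Hc tsmult_closed[OF XG]] ttranspose_tsmult[OF p XG] XG_sym
      unfolding H_def gram[OF Rc] ..
    finally show ?thesis .
  qed
  \<comment> \<open>By \<open>RB\<close> the term with the multiplier cancels, leaving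
    \<open>- H\<close> and \<open>- H *\<^sub>T (X\<^sup>\<top> *\<^sub>T X)\<close>.\<close>
  have F4: "lamI = (- 1) \<cdot>\<^sub>T (H *\<^sub>T S)"
  proof -
    have "X\<^sup>\<top> *\<^sub>T K\<^sup>\<top> *\<^sub>T K *\<^sub>T X = X\<^sup>\<top> *\<^sub>T G"
      by (simp only: G_def assoc[OF tr[OF X] tr[OF K] KX] assoc[OF pc[OF tr[OF X] tr[OF K]] K X])
    moreover have "R\<^sup>\<top> *\<^sub>T R *\<^sub>T X\<^sup>\<top> *\<^sub>T X = H *\<^sub>T (X\<^sup>\<top> *\<^sub>T X)"
      unfolding H_def[symmetric] by (rule assoc[OF Hc tr[OF X] X])
    moreover have "H *\<^sub>T S = H +\<^sub>T H *\<^sub>T (X\<^sup>\<top> *\<^sub>T X)"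
      unfolding S_def dl[OF Hc I XX] tprod_tid_right[OF p Hc] ..
    ultimately show ?thesis
      unfolding lamI RB using Hc HXX XG
      by (intro tensor_eqI[of _ 1 1 p]) (simp_all add: tensor_closed tensor_index[of _ 1 1 p])
  qed

  define P where "P = A\<^sup>\<top> *\<^sub>T A +\<^sub>T K\<^sup>\<top> *\<^sub>T K *\<^sub>T tkron lamK (tid n p)"
  define V where "V = tuminus lamK *\<^sub>T X\<^sup>\<top> *\<^sub>T K\<^sup>\<top> *\<^sub>T K *\<^sub>T X +\<^sub>T B\<^sup>\<top> *\<^sub>T B"
  note kron = tkron_tid(1)[OF p lamKc, of n]
  have Pc: "P \<in> tensors n n p" unfolding P_def by (rule tensor_closed A KK kron)+
  have lXG: "lamK *\<^sub>T (X\<^sup>\<top> *\<^sub>T G) \<in> tensors 1 1 p" and BB: "B\<^sup>\<top> *\<^sub>T B \<in> tensors 1 1 p"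
    and AB: "A\<^sup>\<top> *\<^sub>T B \<in> tensors n 1 p" and BAX: "B\<^sup>\<top> *\<^sub>T (A *\<^sub>T X) \<in> tensors 1 1 p"
    and AAX: "A\<^sup>\<top> *\<^sub>T (A *\<^sub>T X) \<in> tensors n 1 p" and ARS: "A\<^sup>\<top> *\<^sub>T (R *\<^sub>T S) \<in> tensors n 1 p"
    and XHS: "X *\<^sub>T (H *\<^sub>T S) \<in> tensors n 1 p" and XGS: "X\<^sup>\<top> *\<^sub>T G *\<^sub>T S \<in> tensors 1 1 p"
    by (rule tensor_closed A B X XG lamKc AX RS HS Sc)+
  have V_eq: "V = (- 1) \<cdot>\<^sub>T (lamK *\<^sub>T (X\<^sup>\<top> *\<^sub>T G)) +\<^sub>T B\<^sup>\<top> *\<^sub>T B"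
  proof -
    note l = tsmult_closed[OF lamKc, of "- 1"]
    show ?thesis
      unfolding V_def tuminus_conv_tsmult assoc[OF l tr[OF X] tr[OF K]]
        assoc[OF l pc[OF tr[OF X] tr[OF K]] K] assoc[OF l pc[OF pc[OF tr[OF X] tr[OF K]] K] X]
        assoc[OF pc[OF tr[OF X] tr[OF K]] K X] assoc[OF tr[OF X] tr[OF K] KX]
        G_def[symmetric] sl[OF lamKc XG] ..
  qed
  have Vc: "V \<in> tensors 1 1 p" unfolding V_eq by (rule tensor_closed lXG BB)+

  \<comment> \<open>The Kronecker term contributes \<open>G *\<^sub>T lamK\<close>, which
    \<open>F1\<close> expands; by \<open>F2\<close>, everything except
    \<open>X *\<^sub>T (H *\<^sub>T S)\<close> cancels against
    \<open>A\<^sup>\<top> *\<^sub>T B\<close>.\<close>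
  have row1: "P *\<^sub>T X +\<^sub>T A\<^sup>\<top> *\<^sub>T B *\<^sub>T ((- 1) \<cdot>\<^sub>T tid 1 p) = X *\<^sub>T (H *\<^sub>T S)"
  proof -
    have "K\<^sup>\<top> *\<^sub>T K *\<^sub>T tkron lamK (tid n p) *\<^sub>T X = G *\<^sub>T lamK"
      unfolding assoc[OF KK kron X] tkron_tid_tprod[OF p lamKc X] G_def
      by (simp only: assoc[OF KK X lamKc, symmetric] assoc[OF tr[OF K] K X])
    also have "\<dots> = (A\<^sup>\<top> *\<^sub>T R +\<^sub>T X *\<^sub>T H) *\<^sub>T S"
      unfolding lamK_S sr[OF Gc Sc] sl[OF Gc Sc, symmetric] F1 ..
    also have "\<dots> = A\<^sup>\<top> *\<^sub>T (R *\<^sub>T S) +\<^sub>T X *\<^sub>T (H *\<^sub>T S)"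
      unfolding dr[OF AR XH Sc] assoc[OF tr[OF A] Rc Sc] assoc[OF X Hc Sc] ..
    finally have "P *\<^sub>T X = A\<^sup>\<top> *\<^sub>T (A *\<^sub>T X) +\<^sub>T (A\<^sup>\<top> *\<^sub>T (R *\<^sub>T S) +\<^sub>T X *\<^sub>T (H *\<^sub>T S))"
      unfolding P_def dr[OF pc[OF tr[OF A] A] pc[OF KK kron] X] assoc[OF tr[OF A] A X] by simp
    moreover have "A\<^sup>\<top> *\<^sub>T B = A\<^sup>\<top> *\<^sub>T (A *\<^sub>T X) +\<^sub>T A\<^sup>\<top> *\<^sub>T (R *\<^sub>T S)"
      by (subst F2) (rule dl[OF tr[OF A] AX RS])
    ultimately show ?thesis
      unfolding sr[OF AB I] tprod_tid_right[OF p AB] using AAX ARS XHS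
      by (intro tensor_eqI[of _ n 1 p]) (simp_all add: tensor_closed tensor_index[of _ n 1 p])
  qed
  have row2: "B\<^sup>\<top> *\<^sub>T A *\<^sub>T X +\<^sub>T V *\<^sub>T ((- 1) \<cdot>\<^sub>T tid 1 p) = (- 1) \<cdot>\<^sub>T (H *\<^sub>T S)"
  proof -
    have "B\<^sup>\<top> *\<^sub>T B = B\<^sup>\<top> *\<^sub>T (A *\<^sub>T X) +\<^sub>T B\<^sup>\<top> *\<^sub>T R *\<^sub>T S"
      using dl[OF tr[OF B] AX RS] assoc[OF tr[OF B] Rc Sc] F2 by simp
    also have "B\<^sup>\<top> *\<^sub>T R *\<^sub>T S = H *\<^sub>T S +\<^sub>T \<mu> \<cdot>\<^sub>T (X\<^sup>\<top> *\<^sub>T G *\<^sub>T S)"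
      unfolding F3 dr[OF Hc tsmult_closed[OF XG] Sc] sl[OF XG Sc] ..
    finally have "B\<^sup>\<top> *\<^sub>T B = B\<^sup>\<top> *\<^sub>T (A *\<^sub>T X) +\<^sub>T (H *\<^sub>T S +\<^sub>T \<mu> \<cdot>\<^sub>T (X\<^sup>\<top> *\<^sub>T G *\<^sub>T S))" .
    \<comment> \<open>Tubes commute, so this term of \<open>V\<close> cancels the multiplier term of
      \<open>B\<^sup>\<top> *\<^sub>T B\<close>.\<close>
    moreover have "lamK *\<^sub>T (X\<^sup>\<top> *\<^sub>T G) = \<mu> \<cdot>\<^sub>T (X\<^sup>\<top> *\<^sub>T G *\<^sub>T S)"
      unfolding lamK_S sl[OF Sc XG] tube_tprod_commute[OF p Sc XG] ..
    ultimately show ?thesis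
      unfolding sr[OF Vc I] tprod_tid_right[OF p Vc] assoc[OF tr[OF B] A X]
      unfolding V_eq using BAX HS XGS
      by (intro tensor_eqI[of _ 1 1 p]) (simp_all add: tensor_closed tensor_index[of _ 1 1 p])
  qed

  have mI: "(- 1) \<cdot>\<^sub>T tid 1 p \<in> tensors 1 1 p" by (rule tensor_closed)+
  note XI = tvcat_closed[OF X mI]
  have lamIc: "lamI \<in> tensors 1 1 p" unfolding F4 by (rule tensor_closed HS)+
  have "Psi *\<^sub>T tvcat X (tuminus (tid 1 p)) = tvcat (X *\<^sub>T (H *\<^sub>T S)) ((- 1) \<cdot>\<^sub>T (H *\<^sub>T S))"
    unfolding Psi P_def[symmetric] V_def[symmetric]
    unfolding tuminus_conv_tsmult tblock_def
      tvcat_tprod[OF p thcat_closed[OF Pc AB] thcat_closed[OF BA Vc] XI]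
      thcat_tprod_tvcat[OF p Pc AB X mI] thcat_tprod_tvcat[OF p BA Vc X mI] row1 row2 ..
  \<comment> \<open>By \<open>F4\<close> both rows are multiples of \<open>lamI\<close>; the double
    sign in the lower row matches the negated identity tube there.\<close>
  also have "\<dots> = tvcat ((- 1) \<cdot>\<^sub>T (X *\<^sub>T lamI)) ((- 1) \<cdot>\<^sub>T ((- 1) \<cdot>\<^sub>T lamI))"
  proof -
    have "(- 1) \<cdot>\<^sub>T (- 1) \<cdot>\<^sub>T T = T" if "T \<in> tensors s t p" for T s t
      using that by (intro tensor_eqI[of _ s t p]) (simp_all add: tensor_closed tensor_index[of _ s t p])
    then show ?thesis
      using XHS HS tsmult_closed[OF HS, of "- 1"] unfolding F4 sr[OF X HS] by metis
  qed
  also have "\<dots> = tuminus (tvcat X (tuminus (tid 1 p))) *\<^sub>T lamI"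
    unfolding tuminus_conv_tsmult sl[OF XI lamIc] tvcat_tprod[OF p X mI lamIc] sl[OF I lamIc]
      tprod_tid_left[OF p lamIc] tsmult_tvcat[OF pc[OF X lamIc] tsmult_closed[OF lamIc]] ..
  finally show ?thesis .
qed

end
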